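(* Let $n,m\ge 1$ and consider the series interconnection \[ \dot x^1 = f^1(t,x^1),\qquad \dot x^2 = f^2(t,x^2,x^1), \] with $x^1\in\mathbb{R}^n$, $x^2\in\mathbb{R}^m$, where $f^1,f^2$ are $C^1$ and the trajectories evolve in a convex state space $\Omega^1\times\Omega^2\subseteq\mathbb{R}^n\times\mathbb{R}^m$. Write $x=(x^1,x^2)$ and $J^{ij}:=\frac{\partial}{\partial x^j}f^i$, so that the Jacobian of the system is \[ J(t,x)=\begin{bmatrix}J^{11}(t,x^1) & 0\\ J^{21}(t,x) & J^{22}(t,x)\end{bmatrix}. \] Assume that $J^{21}(t,x)$ is uniformly bounded for all $x\in\Omega^1\times\Omega^2$ and $t\ge 0$. Fix $k\in\{1,\dots,n+m\}$ and let $i_1:=\max\{0,k-n\}$, $i_2:=\min\{m,k\}$. Suppose there exist matrix measures $\mu_i$ induced by (possibly different) $L_p$ vector norms and constants $\eta_i>0$ such that \[ \mu_i\big((J^{11}(t,x^1))^{[k-i]}\big)+\mu_i\big((J^{22}(t,x))^{[i]}\big)\le -\eta_i<0 \] for all $i\in\{i_1,\dots,i_2\}$, all $x\in\Omega^1\times\Omega^2$ and all $t\ge 0$. Then the system is $k$-contracting.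
   Context: Compounds: for $C\in\mathbb{R}^{p\times q}$ and $k\le\min\{p,q\}$, the $k$th multiplicative compound $C^{(k)}$ is the $\binom{p}{k}\times\binom{q}{k}$ matrix of all $k\times k$ minors of $C$, rows and columns indexed by increasing $k$-tuples of indices in lexicographic order. For a square matrix $A$, the $k$th additive compound is $A^{[k]}:=\frac{d}{dt}(\exp(At))^{(k)}\big|_{t=0}$. By convention, for a square matrix $M$, $M^{(0)}:=1$ and $M^{[0]}:=0$ (a $1\times 1$ matrix). Matrix measure: for a vector norm $|\cdot|$ with induced matrix norm $\|\cdot\|$, $\mu(A):=\lim_{\varepsilon\to0^+}(\|I+\varepsilon A\|-1)/\varepsilon$. $k$-contraction: for a system $\dot z=F(t,z)$, $F$ of class $C^1$, whose trajectories $z(t,a)$ (with $z(0)=a$) evolve in a convex set $D\subseteq\mathbb{R}^N$, let $\Phi_a(t)$ solve $\dot\Phi=\frac{\partial F}{\partial z}(t,z(t,a))\Phi$, $\Phi_a(0)=I_N$. The system is called $k$-contracting if there exist $\eta>0$ and a norm on $\mathbb{R}^{\binom{N}{k}}$ with induced matrix norm $\|\cdot\|$ such that $\|(\Phi_a(t))^{(k)}\|\le e^{-\eta t}$ for all $t\ge0$ and $a\in D$ (i.e., the variational dynamics contract the volume of $k$-dimensional parallelotopes at an exponential rate). *)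

theory Defs
  imports "HOL-Analysis.Analysis" "HOL-Library.List_Lexorder"
begin

type_synonym nmat = "nat \<Rightarrow> nat \<Rightarrow> real"

definition mat_id :: "nat \<Rightarrow> nmat" where
  "mat_id d = (\<lambda>i j. if i = j \<and> i < d then 1 else 0)"

definition mat_mult :: "nat \<Rightarrow> nmat \<Rightarrow> nmat \<Rightarrow> nmat" where
  "mat_mult d A B = (\<lambda>i j. \<Sum>l<d. A i l * B l j)"

definition mat_pow :: "nat \<Rightarrow> nmat \<Rightarrow> nat \<Rightarrow> nmat" where
  "mat_pow d A l = ((mat_mult d A) ^^ l) (mat_id d)"

definition mat_exp :: "nat \<Rightarrow> nmat \<Rightarrow> nmat" where
  "mat_exp d A = (\<lambda>i j. \<Sum>l. mat_pow d A l i j / fact l)"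

definition detn :: "nat \<Rightarrow> nmat \<Rightarrow> real" where
  "detn k A = (\<Sum>p | p permutes {..<k}. of_int (sign p) * (\<Prod>i<k. A i (p i)))"

definition ktuples :: "nat \<Rightarrow> nat \<Rightarrow> nat list list" where
  "ktuples d k = sorted_list_of_set
     {xs. sorted_wrt (<) xs \<and> length xs = k \<and> set xs \<subseteq> {..<d}}"

definition mult_compound :: "nat \<Rightarrow> nat \<Rightarrow> nat \<Rightarrow> nmat \<Rightarrow> nmat" where
  "mult_compound p q k C = (\<lambda>i j.
     if i < p choose k \<and> j < q choose k
     then detn k (\<lambda>a b. C (ktuples p k ! i ! a) (ktuples q k ! j ! b))
     else 0)"

definition add_compound :: "nat \<Rightarrow> nat \<Rightarrow> nmat \<Rightarrow> nmat" where
  "add_compound d k A = (\<lambda>i j.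
     deriv (\<lambda>t. mult_compound d d k (mat_exp d (\<lambda>a b. t * A a b)) i j) 0)"

definition vspace :: "nat \<Rightarrow> (nat \<Rightarrow> real) set" where
  "vspace d = {v. \<forall>i\<ge>d. v i = 0}"

definition is_norm_on :: "nat \<Rightarrow> ((nat \<Rightarrow> real) \<Rightarrow> real) \<Rightarrow> bool" where
  "is_norm_on d \<nu> \<longleftrightarrow>
     (\<forall>v\<in>vspace d. 0 \<le> \<nu> v \<and> (\<nu> v = 0 \<longleftrightarrow> v = (\<lambda>_. 0))) \<and>
     (\<forall>v\<in>vspace d. \<forall>c. \<nu> (\<lambda>i. c * v i) = \<bar>c\<bar> * \<nu> v) \<and>
     (\<forall>v\<in>vspace d. \<forall>w\<in>vspace d. \<nu> (\<lambda>i. v i + w i) \<le> \<nu> v + \<nu> w)"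

definition lp_norm :: "nat \<Rightarrow> ereal \<Rightarrow> (nat \<Rightarrow> real) \<Rightarrow> real" where
  "lp_norm d p v = (if p = \<infinity> then Max (insert 0 {\<bar>v i\<bar> | i. i < d})
                    else (\<Sum>i<d. \<bar>v i\<bar> powr real_of_ereal p) powr (1 / real_of_ereal p))"

definition mat_vec :: "nat \<Rightarrow> nmat \<Rightarrow> (nat \<Rightarrow> real) \<Rightarrow> (nat \<Rightarrow> real)" where
  "mat_vec d A v = (\<lambda>i. if i < d then \<Sum>j<d. A i j * v j else 0)"

definition induced_norm :: "nat \<Rightarrow> ((nat \<Rightarrow> real) \<Rightarrow> real) \<Rightarrow> nmat \<Rightarrow> real" where
  "induced_norm d \<nu> A = Sup {\<nu> (mat_vec d A v) | v. v \<in> vspace d \<and> \<nu> v = 1}"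

definition matrix_measure :: "nat \<Rightarrow> ((nat \<Rightarrow> real) \<Rightarrow> real) \<Rightarrow> nmat \<Rightarrow> real" where
  "matrix_measure d \<nu> A =
     Lim (at_right 0) (\<lambda>\<epsilon>. (induced_norm d \<nu> (\<lambda>i j. mat_id d i j + \<epsilon> * A i j) - 1) / \<epsilon>)"

definition C1_on :: "'a::real_normed_vector set \<Rightarrow> ('a \<Rightarrow> 'b::real_normed_vector) \<Rightarrow> bool" where
  "C1_on U g \<longleftrightarrow> (\<exists>g'. (\<forall>z\<in>U. (g has_derivative blinfun_apply (g' z)) (at z)) \<and> continuous_on U g')"

definition jac :: "(nat \<Rightarrow> 'a::euclidean_space) \<Rightarrow> (nat \<Rightarrow> 'b::euclidean_space)
                    \<Rightarrow> ('a \<Rightarrow> 'b) \<Rightarrow> 'a \<Rightarrow> nmat" where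
  "jac ea eb g x = (\<lambda>i j. frechet_derivative g (at x) (ea j) \<bullet> eb i)"

definition lenum :: "nat \<Rightarrow> 'n::{finite,linorder}" where
  "lenum i = sorted_list_of_set (UNIV :: 'n set) ! i"

definition std_basis :: "nat \<Rightarrow> (real, 'n::{finite,linorder}) vec" where
  "std_basis i = axis (lenum i) 1"

definition block_basis :: "nat \<Rightarrow> ((real, 'n::{finite,linorder}) vec) \<times> ((real, 'm::{finite,linorder}) vec)" where
  "block_basis i = (if i < CARD('n) then (std_basis i, 0) else (0, std_basis (i - CARD('n))))"

definition k_contracting :: "nat \<Rightarrow> (nat \<Rightarrow> 'a::euclidean_space) \<Rightarrow> (real \<Rightarrow> 'a \<Rightarrow> 'a) \<Rightarrow> 'a set \<Rightarrow> bool" where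
  "k_contracting k e F D \<longleftrightarrow>
    (\<exists>\<eta>>0. \<exists>\<nu>. is_norm_on (DIM('a) choose k) \<nu> \<and>
      (\<forall>(z :: real \<Rightarrow> 'a) (\<Phi> :: real \<Rightarrow> nmat).
         (\<forall>t\<ge>0. z t \<in> D \<and> (z has_vector_derivative F t (z t)) (at t within {0..})) \<and>
         (\<forall>i<DIM('a). \<forall>j<DIM('a). \<Phi> 0 i j = mat_id DIM('a) i j \<and>
            (\<forall>t\<ge>0. ((\<lambda>s. \<Phi> s i j) has_real_derivative
                        (\<Sum>l<DIM('a). jac e e (F t) (z t) i l * \<Phi> t l j)) (at t within {0..})))
         \<longrightarrow> (\<forall>t\<ge>0. induced_norm (DIM('a) choose k) \<nu> (mult_compound DIM('a) DIM('a) k (\<Phi> t))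
                        \<le> exp (- \<eta> * t))))"

end

theory Submission
  imports Defs
begin

text \<open>
  For fixed \<open>v\<close>, the coordinates of \<open>\<Phi>(t)\<^sup>(\<^sup>k\<^sup>) v\<close> extend to an alternating
  function \<open>Y\<^sub>t\<close> of index tuples that satisfies
  \<open>Y'(x) = \<Sum>\<^sub>a \<Sum>\<^sub>l J(x\<^sub>a, l) Y(x[a := l])\<close>. Sort the increasing \<open>k\<close>-tuples by the number \<open>i\<close>
  of their entries that belong to the second subsystem. Because \<open>J\<close> is block triangular, the part
  \<open>X\<^sub>i\<close> of \<open>Y\<close> with \<open>i\<close> such entries, read as a matrix, satisfies
  \<open>X\<^sub>i' = A X\<^sub>i + X\<^sub>i B\<^sup>T + R\<^sub>i\<close>, where \<open>A\<close> and \<open>B\<close> are the additive compounds of orders \<open>k - i\<close>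
  and \<open>i\<close> of the two diagonal blocks and \<open>R\<^sub>i\<close> is bounded by a multiple of \<open>|X\<^bsub>i-1\<^esub>|\<close>.
  Hence the entrywise \<open>L\<^sub>p\<close> norms satisfy \<open>D\<^sup>+|X\<^sub>i| \<le> -\<eta>\<^sub>i |X\<^sub>i| + K |X\<^bsub>i-1\<^esub>|\<close>, and the norm
  \<open>\<Sum>\<^sub>i \<delta>\<^sup>i |X\<^sub>i|\<close> decays exponentially once \<open>\<delta>\<close> is small.
\<close>

text \<open>Replacing an entry of an increasing tuple may leave it unsorted or with a repetition.
  Extending the coordinates to all tuples keeps the signs in the explicit formulas for additive
  compounds out of the differential equation; a value at an unsorted tuple is compared with a block
  entry only in absolute value. The map X -> A X + X B^T is the Kronecker sum of A and B acting on
  the entries of X, and its measure for an entrywise L_p norm is at most the sum of the measures of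
  A and B. This is why the hypothesis adds two measures. Norms need not be differentiable, so decay
  is derived from upper bounds on right-hand increments. The block J21 replaces a shifted index by
  an unshifted one, so block i is driven only by block i - 1. With weights \<delta>^i the total
  coupling carries a factor \<delta>, which is chosen so that the coupling uses up half of the rate.
  The resulting norm depends on bounds, dimensions and exponents, never on a trajectory, as
  k-contraction requires.\<close>

section \<open>Vector norms and matrix measures\<close>

lemma lp_norm_cong: "(\<And>i. i < d \<Longrightarrow> v i = w i) \<Longrightarrow> lp_norm d p v = lp_norm d p w"
proof -
  assume *: "\<And>i. i < d \<Longrightarrow> v i = w i"
  have "{\<bar>v i\<bar> | i. i < d} = {\<bar>w i\<bar> | i. i < d}" by (rule Collect_cong, rule ex_cong1) (auto simp: *)
  then show ?thesis unfolding lp_norm_def using * by simp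
qed

lemma lp_norm_infinity_le_iff: "0 \<le> c \<Longrightarrow> lp_norm d \<infinity> v \<le> c \<longleftrightarrow> (\<forall>i<d. \<bar>v i\<bar> \<le> c)"
proof -
  have "finite {\<bar>v i\<bar> | i. i < d}" by simp
  then show "0 \<le> c \<Longrightarrow> ?thesis" unfolding lp_norm_def by (auto simp: Max_le_iff)
qed

lemma lp_norm_ereal: "lp_norm d (ereal r) v = (\<Sum>i<d. \<bar>v i\<bar> powr r) powr (1 / r)"
  by (simp add: lp_norm_def)

lemma lp_norm_nonneg: "0 \<le> lp_norm d p v"
proof (cases "p = \<infinity>")
  case True
  have "finite {\<bar>v i\<bar> | i. i < d}" by simp
  then show ?thesis using True unfolding lp_norm_def by (auto intro: Max_ge)
qed (simp add: lp_norm_def)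

lemma lp_norm_powr:
  assumes "1 \<le> r" shows "lp_norm d (ereal r) v powr r = (\<Sum>i<d. \<bar>v i\<bar> powr r)"
  using assms by (simp add: lp_norm_ereal powr_powr sum_nonneg)

lemma lp_norm_ereal_le_iff:
  assumes "1 \<le> r" "0 \<le> c"
  shows "lp_norm d (ereal r) v \<le> c \<longleftrightarrow> (\<Sum>i<d. \<bar>v i\<bar> powr r) \<le> c powr r"
proof -
  have "lp_norm d (ereal r) v \<le> c \<longleftrightarrow> lp_norm d (ereal r) v powr r \<le> c powr r"
    using assms lp_norm_nonneg[of d "ereal r" v] powr_less_mono2[of r c "lp_norm d (ereal r) v"]
      powr_mono2[of r "lp_norm d (ereal r) v" c] by (auto simp: not_le[symmetric])
  then show ?thesis using lp_norm_powr[OF assms(1)] by simp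
qed

lemma ereal_ge_one_cases:
  assumes "1 \<le> (p::ereal)"
  obtains "p = \<infinity>" | r where "p = ereal r" "1 \<le> r"
  using assms by (cases p) auto

lemma lp_norm_mono:
  assumes "1 \<le> p" "\<And>i. i < d \<Longrightarrow> \<bar>v i\<bar> \<le> \<bar>w i\<bar>"
  shows "lp_norm d p v \<le> lp_norm d p w"
  using assms(1)
proof (cases rule: ereal_ge_one_cases)
  case 1
  then show ?thesis using lp_norm_infinity_le_iff[of "lp_norm d \<infinity> w" d w] assms(2)
    by (simp add: lp_norm_infinity_le_iff lp_norm_nonneg) (meson order_trans)
next
  case (2 r)
  then show ?thesis
    using assms(2) by (auto simp: lp_norm_ereal_le_iff lp_norm_nonneg lp_norm_powr intro!: sum_mono powr_mono2)
qed

lemma abs_le_lp_norm: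
  assumes "1 \<le> p" "i < d" shows "\<bar>v i\<bar> \<le> lp_norm d p v"
  using assms(1)
proof (cases rule: ereal_ge_one_cases)
  case 1
  then show ?thesis using lp_norm_infinity_le_iff[of "lp_norm d \<infinity> v" d v] assms(2) lp_norm_nonneg by simp
next
  case (2 r)
  have "\<bar>v i\<bar> powr r \<le> (\<Sum>i<d. \<bar>v i\<bar> powr r)"
    using assms(2) by (intro member_le_sum) auto
  then have "\<bar>v i\<bar> powr r \<le> lp_norm d p v powr r" using 2 lp_norm_powr by simp
  then show ?thesis
    using 2 lp_norm_nonneg[of d p v] powr_less_mono2[of r "lp_norm d p v" "\<bar>v i\<bar>"] by fastforce
qed

lemma lp_norm_const_zero [simp]: "lp_norm d p (\<lambda>_. 0) = 0"
proof (cases "p = \<infinity>")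
  case True
  have "lp_norm d \<infinity> (\<lambda>_. 0) \<le> 0" by (simp add: lp_norm_infinity_le_iff)
  then show ?thesis using lp_norm_nonneg[of d \<infinity> "\<lambda>_. 0"] True by simp
qed (auto simp: lp_norm_def)

lemma lp_norm_eq_0_iff:
  assumes "1 \<le> p" shows "lp_norm d p v = 0 \<longleftrightarrow> (\<forall>i<d. v i = 0)"
proof
  assume *: "lp_norm d p v = 0"
  show "\<forall>i<d. v i = 0"
  proof (intro allI impI)
    fix i assume "i < d"
    from abs_le_lp_norm[OF assms this, of v] show "v i = 0" using * by simp
  qed
next
  assume "\<forall>i<d. v i = 0"
  then have "lp_norm d p v = lp_norm d p (\<lambda>_. 0)" by (intro lp_norm_cong) auto
  then show "lp_norm d p v = 0" by simp
qed

lemma lp_norm_scale: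
  assumes "1 \<le> p" shows "lp_norm d p (\<lambda>i. c * v i) = \<bar>c\<bar> * lp_norm d p v"
proof -
  \<comment> \<open>One inequality for every scalar is enough: applied to \<open>inverse c\<close>
    and the scaled vector it yields the reverse one.\<close>
  have le: "lp_norm d p (\<lambda>i. c * v i) \<le> \<bar>c\<bar> * lp_norm d p v" for c v
    using assms
  proof (cases rule: ereal_ge_one_cases)
    case 1
    then show ?thesis using lp_norm_nonneg[of d \<infinity> v] abs_le_lp_norm[OF assms, of _ d v]
      by (auto simp: lp_norm_infinity_le_iff abs_mult intro!: mult_left_mono)
  next
    case (2 r)
    then show ?thesis using lp_norm_nonneg[of d p v]
      by (simp add: lp_norm_ereal_le_iff abs_mult powr_mult sum_distrib_left[symmetric] lp_norm_powr)
  qed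
  show ?thesis
  proof (cases "c = 0")
    case False
    have "lp_norm d p v \<le> \<bar>inverse c\<bar> * lp_norm d p (\<lambda>i. c * v i)"
      using le[of "inverse c" "\<lambda>i. c * v i"] False by (simp add: mult.assoc[symmetric])
    then have "\<bar>c\<bar> * lp_norm d p v \<le> \<bar>c\<bar> * (\<bar>inverse c\<bar> * lp_norm d p (\<lambda>i. c * v i))"
      by (intro mult_left_mono) auto
    also have "\<dots> = lp_norm d p (\<lambda>i. c * v i)"
      using False by (simp add: mult.assoc[symmetric] abs_mult[symmetric])
    finally show ?thesis using le[of c v] by simp
  qed simp
qed

text \<open>At a zero endpoint the claim reduces to \<open>u powr r\<close> being at most
  \<open>u\<close> for u in [0, 1]; elsewhere it is convexity on the positive half line.\<close>

lemma powr_convex_ineq: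
  fixes x y :: real
  assumes "1 \<le> r" "0 \<le> s" "s \<le> 1" "0 \<le> x" "0 \<le> y"
  shows "((1 - s) * x + s * y) powr r \<le> (1 - s) * x powr r + s * y powr r"
proof -
  have le: "(u * z) powr r \<le> u * z powr r" if "0 \<le> u" "u \<le> 1" "0 \<le> z" for u z :: real
  proof -
    have "u powr r \<le> u" using that assms(1) powr_mono'[of 1 r u] by (cases "u = 0") auto
    then show ?thesis using that by (simp add: powr_mult mult_right_mono)
  qed
  consider "x = 0" | "y = 0" | "0 < x" "0 < y" using assms by linarith
  then show ?thesis
  proof cases
    case 1 then show ?thesis using le[of s y] assms by simp
  next
    case 2 then show ?thesis using le[of "1 - s" x] assms by simp
  next
    case 3 then show ?thesis using convex_onD[OF powr_convex[OF assms(1)] assms(2,3), of x y] by simp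
  qed
qed

text \<open>Minkowski's inequality from convexity of the power: after division by the sum of the
  norms, the entries of the sum are dominated by a convex combination of two unit vectors.\<close>

lemma lp_norm_triangle:
  assumes "1 \<le> p" shows "lp_norm d p (\<lambda>i. v i + w i) \<le> lp_norm d p v + lp_norm d p w"
  using assms
proof (cases rule: ereal_ge_one_cases)
  case 1
  have "\<bar>v i + w i\<bar> \<le> lp_norm d p v + lp_norm d p w" if "i < d" for i
    using abs_le_lp_norm[OF assms that, of v] abs_le_lp_norm[OF assms that, of w] by linarith
  then show ?thesis using 1 lp_norm_nonneg[of d p v] lp_norm_nonneg[of d p w]
    by (simp add: lp_norm_infinity_le_iff)
next
  case (2 r)
  define a b where "a = lp_norm d p v" and "b = lp_norm d p w"
  show ?thesis
  proof (cases "a = 0 \<or> b = 0")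
    case True
    then have "(\<forall>i<d. v i = 0) \<or> (\<forall>i<d. w i = 0)"
      using lp_norm_eq_0_iff[OF assms] by (auto simp: a_def b_def)
    then consider "\<And>i. i < d \<Longrightarrow> v i + w i = w i" | "\<And>i. i < d \<Longrightarrow> v i + w i = v i" by auto
    then have "lp_norm d p (\<lambda>i. v i + w i) = lp_norm d p w \<or> lp_norm d p (\<lambda>i. v i + w i) = lp_norm d p v"
      by cases (blast intro: lp_norm_cong)+
    then show ?thesis using lp_norm_nonneg[of d p v] lp_norm_nonneg[of d p w] by auto
  next
    case False
    then have pos: "a > 0" "b > 0" using lp_norm_nonneg[of d p v] lp_norm_nonneg[of d p w]
      by (auto simp: a_def b_def less_le)
    \<comment> \<open>The weights a/(a+b) and b/(a+b) cancel the normalisation of \<open>v\<close>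
      and \<open>w\<close>.\<close>
    define s where "s = b / (a + b)"
    have s: "0 \<le> s" "s \<le> 1" "1 - s = a / (a + b)" using pos by (auto simp: s_def field_simps)
    have unit: "(\<Sum>i<d. (\<bar>x i\<bar> / c) powr r) = 1" if "c = lp_norm d p x" "c > 0" for c x
    proof -
      have "(\<Sum>i<d. (\<bar>x i\<bar> / c) powr r) = (\<Sum>i<d. \<bar>x i\<bar> powr r) / c powr r"
        using that by (simp add: powr_divide sum_divide_distrib)
      also have "\<dots> = 1" using that lp_norm_powr[OF 2(2), of d x] unfolding 2(1) by (metis divide_self_if less_irrefl powr_gt_zero)
      finally show ?thesis .
    qed
    have *: "\<bar>v i + w i\<bar> powr r \<le> (a + b) powr r * ((1 - s) * (\<bar>v i\<bar> / a) powr r + s * (\<bar>w i\<bar> / b) powr r)" for i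
    proof -
      have "\<bar>v i\<bar> + \<bar>w i\<bar> = (a + b) * ((1 - s) * (\<bar>v i\<bar> / a) + s * (\<bar>w i\<bar> / b))"
      proof -
        have "(1 - s) * (\<bar>v i\<bar> / a) = \<bar>v i\<bar> / (a + b)" "s * (\<bar>w i\<bar> / b) = \<bar>w i\<bar> / (a + b)"
          using pos unfolding s(3) by (simp_all add: s_def)
        then show ?thesis using pos by (simp add: add_divide_distrib[symmetric])
      qed
      then have "\<bar>v i + w i\<bar> powr r \<le> ((a + b) * ((1 - s) * (\<bar>v i\<bar> / a) + s * (\<bar>w i\<bar> / b))) powr r"
        using 2 abs_triangle_ineq[of "v i" "w i"] by (intro powr_mono2) auto
      also have "\<dots> = (a + b) powr r * ((1 - s) * (\<bar>v i\<bar> / a) + s * (\<bar>w i\<bar> / b)) powr r"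
        using pos s by (intro powr_mult)
      also have "((1 - s) * (\<bar>v i\<bar> / a) + s * (\<bar>w i\<bar> / b)) powr r \<le> (1 - s) * (\<bar>v i\<bar> / a) powr r + s * (\<bar>w i\<bar> / b) powr r"
        using pos by (intro powr_convex_ineq 2(2) s(1,2)) auto
      finally show ?thesis using pos by (simp add: mult_left_mono)
    qed
    have "(\<Sum>i<d. \<bar>v i + w i\<bar> powr r) \<le> (\<Sum>i<d. (a + b) powr r * ((1 - s) * (\<bar>v i\<bar> / a) powr r + s * (\<bar>w i\<bar> / b) powr r))"
      by (intro sum_mono *)
    also have "\<dots> = (a + b) powr r"
      using unit[OF a_def pos(1)] unit[OF b_def pos(2)]
      by (simp add: sum_distrib_left[symmetric] sum.distrib)
    finally show ?thesis using pos 2 by (simp add: lp_norm_ereal_le_iff a_def b_def)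
  qed
qed

text \<open>With s the sum on the right, |v_i|^r <= s^(r-1) |v_i|. This crude bound, the same for
  every exponent, serves to estimate remainders and couplings.\<close>

lemma lp_norm_le_sum:
  assumes "1 \<le> p" shows "lp_norm d p v \<le> (\<Sum>i<d. \<bar>v i\<bar>)"
  using assms
proof (cases rule: ereal_ge_one_cases)
  case 1
  have "\<bar>v i\<bar> \<le> (\<Sum>i<d. \<bar>v i\<bar>)" if "i < d" for i using that by (intro member_le_sum) auto
  then show ?thesis using 1 by (simp add: lp_norm_infinity_le_iff sum_nonneg)
next
  case (2 r)
  define s where "s = (\<Sum>i<d. \<bar>v i\<bar>)"
  have s0: "0 \<le> s" by (simp add: s_def sum_nonneg)
  have le: "\<bar>v i\<bar> \<le> s" if "i < d" for i unfolding s_def using that by (intro member_le_sum) auto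
  have pw: "x powr r = x powr (r - 1) * x" if "0 \<le> x" for x :: real
    using powr_add[of x "r - 1" 1] that by simp
  have "(\<Sum>i<d. \<bar>v i\<bar> powr r) \<le> (\<Sum>i<d. s powr (r - 1) * \<bar>v i\<bar>)"
    using 2 le by (intro sum_mono) (auto simp: pw intro!: mult_right_mono powr_mono2)
  also have "\<dots> = s powr r" using s0 by (simp add: pw sum_distrib_left[symmetric] s_def)
  finally show ?thesis using 2 s0 by (simp add: lp_norm_ereal_le_iff s_def)
qed

section \<open>Entrywise norms of matrices as iterated L_p norms\<close>

definition grid_norm :: "nat \<Rightarrow> nat \<Rightarrow> ereal \<Rightarrow> nmat \<Rightarrow> real" where
  "grid_norm a b p X = lp_norm a p (\<lambda>r. lp_norm b p (X r))"

text \<open>Both levels use one exponent, so either order of iteration gives the maximum, or the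
  r-th root of the double sum of r-th powers, over all entries. Operators on columns thereby inherit
  the bounds proved for rows.\<close>

lemma grid_norm_transpose:
  assumes "1 \<le> p" shows "grid_norm a b p X = grid_norm b a p (\<lambda>c r. X r c)"
  using assms
proof (cases rule: ereal_ge_one_cases)
  case 1
  have le: "grid_norm a b p X \<le> grid_norm b a p (\<lambda>c r. X r c)" for a b X
  proof -
    have "\<bar>X r c\<bar> \<le> grid_norm b a p (\<lambda>c r. X r c)" if "r < a" "c < b" for r c
    proof -
      have "\<bar>X r c\<bar> \<le> \<bar>lp_norm a p (\<lambda>r. X r c)\<bar>"
        using abs_le_lp_norm[OF assms that(1), of "\<lambda>r. X r c"] by linarith
      also have "\<dots> \<le> grid_norm b a p (\<lambda>c r. X r c)"
        unfolding grid_norm_def using abs_le_lp_norm[OF assms that(2)] .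
      finally show ?thesis .
    qed
    moreover have "0 \<le> grid_norm b a p (\<lambda>c r. X r c)" by (simp add: grid_norm_def lp_norm_nonneg)
    ultimately show ?thesis
      using 1 unfolding grid_norm_def[of a b] by (simp add: lp_norm_infinity_le_iff lp_norm_nonneg)
  qed
  show ?thesis using le[of a b X] le[of b a "\<lambda>c r. X r c"] by simp
next
  case (2 r)
  have "grid_norm a b (ereal r) X = (\<Sum>i<a. \<Sum>j<b. \<bar>X i j\<bar> powr r) powr (1 / r)" for a b X
    by (simp add: grid_norm_def lp_norm_ereal[of a] lp_norm_nonneg lp_norm_powr[OF 2(2)])
  then show ?thesis using 2 by (simp add: sum.swap[of _ "{..<b}" "{..<a}"])
qed

lemma grid_norm_nonneg: "0 \<le> grid_norm a b p X"
  by (simp add: grid_norm_def lp_norm_nonneg)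

lemma grid_norm_cong:
  "(\<And>r c. r < a \<Longrightarrow> c < b \<Longrightarrow> X r c = Y r c) \<Longrightarrow> grid_norm a b p X = grid_norm a b p Y"
  unfolding grid_norm_def by (intro lp_norm_cong) auto

lemma grid_norm_scale:
  assumes "1 \<le> p" shows "grid_norm a b p (\<lambda>r c. s * X r c) = \<bar>s\<bar> * grid_norm a b p X"
  using lp_norm_scale[OF assms, of a "\<bar>s\<bar>"] by (simp add: grid_norm_def lp_norm_scale[OF assms])

lemma grid_norm_triangle:
  assumes "1 \<le> p" shows "grid_norm a b p (\<lambda>r c. X r c + Y r c) \<le> grid_norm a b p X + grid_norm a b p Y"
proof -
  have "grid_norm a b p (\<lambda>r c. X r c + Y r c) \<le> lp_norm a p (\<lambda>r. lp_norm b p (X r) + lp_norm b p (Y r))"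
    unfolding grid_norm_def using lp_norm_triangle[OF assms] lp_norm_nonneg
    by (intro lp_norm_mono assms) (auto simp: abs_of_nonneg lp_norm_nonneg)
  also have "\<dots> \<le> grid_norm a b p X + grid_norm a b p Y"
    unfolding grid_norm_def by (rule lp_norm_triangle[OF assms])
  finally show ?thesis .
qed

lemma abs_le_grid_norm:
  assumes "1 \<le> p" "r < a" "c < b" shows "\<bar>X r c\<bar> \<le> grid_norm a b p X"
  using abs_le_lp_norm[OF assms(1,3), of "X r"] abs_le_lp_norm[OF assms(1,2), of "\<lambda>r. lp_norm b p (X r)"]
  unfolding grid_norm_def by linarith

lemma grid_norm_le_sum:
  assumes "1 \<le> p" shows "grid_norm a b p X \<le> (\<Sum>r<a. \<Sum>c<b. \<bar>X r c\<bar>)"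
proof -
  have "grid_norm a b p X \<le> (\<Sum>r<a. \<bar>lp_norm b p (X r)\<bar>)"
    unfolding grid_norm_def by (rule lp_norm_le_sum[OF assms])
  also have "\<dots> \<le> (\<Sum>r<a. \<Sum>c<b. \<bar>X r c\<bar>)"
    using lp_norm_le_sum[OF assms] by (intro sum_mono) (simp add: lp_norm_nonneg)
  finally show ?thesis .
qed

section \<open>Induced norms and existence of the matrix measure\<close>

lemma bdd_above_induced:
  assumes "1 \<le> p"
  shows "bdd_above {lp_norm d p (mat_vec d A v) | v. v \<in> vspace d \<and> lp_norm d p v = 1}"
proof (rule bdd_aboveI)
  fix x assume "x \<in> {lp_norm d p (mat_vec d A v) | v. v \<in> vspace d \<and> lp_norm d p v = 1}"
  then obtain v where v: "lp_norm d p v = 1" "x = lp_norm d p (mat_vec d A v)" by auto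
  have "x \<le> (\<Sum>i<d. \<bar>mat_vec d A v i\<bar>)" using v lp_norm_le_sum[OF assms] by simp
  also have "\<dots> \<le> (\<Sum>i<d. \<Sum>j<d. \<bar>A i j\<bar>)"
  proof (rule sum_mono)
    fix i assume "i \<in> {..<d}"
    then have "\<bar>mat_vec d A v i\<bar> \<le> (\<Sum>j<d. \<bar>A i j * v j\<bar>)" by (auto simp: mat_vec_def)
    also have "\<dots> \<le> (\<Sum>j<d. \<bar>A i j\<bar>)"
      using abs_le_lp_norm[OF assms, of _ d v] v(1) by (intro sum_mono) (auto simp: abs_mult intro!: mult_left_le)
    finally show "\<bar>mat_vec d A v i\<bar> \<le> (\<Sum>j<d. \<bar>A i j\<bar>)" .
  qed
  finally show "x \<le> (\<Sum>i<d. \<Sum>j<d. \<bar>A i j\<bar>)" .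
qed

lemma lp_norm_mat_vec_le:
  assumes "1 \<le> p"
  shows "lp_norm d p (mat_vec d A v) \<le> induced_norm d (lp_norm d p) A * lp_norm d p v"
proof (cases "lp_norm d p v = 0")
  case True
  then have "lp_norm d p (mat_vec d A v) = lp_norm d p (\<lambda>_. 0)"
    using lp_norm_eq_0_iff[OF assms, of d v] by (intro lp_norm_cong) (auto simp: mat_vec_def)
  then show ?thesis using True by simp
next
  case False
  define c where "c = lp_norm d p v"
  have c: "c > 0" using False lp_norm_nonneg[of d p v] by (simp add: c_def)
  \<comment> \<open>The supremum in \<open>induced_norm\<close> ranges over \<open>vspace d\<close>
    only, whereas \<open>v\<close> is arbitrary; cutting off at \<open>d\<close> changes neither the
    norm nor the product.\<close>
  define w where "w = (\<lambda>i. if i < d then inverse c * v i else 0)"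
  have "lp_norm d p w = lp_norm d p (\<lambda>i. inverse c * v i)" by (intro lp_norm_cong) (simp add: w_def)
  then have w1: "lp_norm d p w = 1" using c by (simp add: lp_norm_scale[OF assms] c_def)
  have "mat_vec d A v i = c * mat_vec d A w i" for i
    using c by (auto simp: mat_vec_def w_def sum_distrib_left field_simps intro!: sum.cong)
  then have "mat_vec d A v = (\<lambda>i. c * mat_vec d A w i)" by auto
  then have "lp_norm d p (mat_vec d A v) = c * lp_norm d p (mat_vec d A w)"
    using c lp_norm_scale[OF assms, of d c "mat_vec d A w"] by simp
  also have "lp_norm d p (mat_vec d A w) \<le> induced_norm d (lp_norm d p) A"
    unfolding induced_norm_def using w1
    by (intro cSup_upper bdd_above_induced assms) (auto simp: vspace_def w_def intro!: exI[of _ w])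
  finally show ?thesis using c by (simp add: mult.commute c_def)
qed

text \<open>Without a unit vector \<open>induced_norm\<close> would be a supremum of the empty set;
  this is where positive dimension enters.\<close>

lemma ex_unit_lp_norm:
  assumes "1 \<le> p" "0 < d" shows "\<exists>v\<in>vspace d. lp_norm d p v = 1"
proof -
  define u :: "nat \<Rightarrow> real" where "u = (\<lambda>i. if i = 0 then 1 else 0)"
  define c where "c = lp_norm d p u"
  have "c > 0" using abs_le_lp_norm[OF assms, of u] by (simp add: u_def c_def)
  then have "lp_norm d p (\<lambda>i. inverse c * u i) = 1"
    by (subst lp_norm_scale[OF assms(1)]) (simp add: c_def[symmetric])
  moreover have "(\<lambda>i. inverse c * u i) \<in> vspace d" using assms by (auto simp: vspace_def u_def)
  ultimately show ?thesis by blast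
qed

lemma induced_norm_le:
  assumes "\<exists>v\<in>vspace d. \<nu> v = 1"
    and "\<And>v. v \<in> vspace d \<Longrightarrow> \<nu> v = 1 \<Longrightarrow> \<nu> (mat_vec d A v) \<le> c"
  shows "induced_norm d \<nu> A \<le> c"
  unfolding induced_norm_def using assms by (intro cSup_least) auto

text \<open>\<open>matrix_measure\<close> is a \<open>Lim\<close>, which carries information only
  once the limit is known to exist. The difference quotient is nondecreasing in \<epsilon> and
  bounded below, so it converges to its infimum.\<close>

lemma matrix_measure_tendsto:
  assumes "1 \<le> p" "0 < d"
  defines "g \<equiv> \<lambda>A \<epsilon>. (induced_norm d (lp_norm d p) (\<lambda>i j. mat_id d i j + \<epsilon> * A i j) - 1) / \<epsilon>"
  shows "(g A \<longlongrightarrow> matrix_measure d (lp_norm d p) A) (at_right 0)"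
proof -
  let ?n = "lp_norm d p" and ?I = "\<lambda>\<epsilon>. induced_norm d (lp_norm d p) (\<lambda>i j. mat_id d i j + \<epsilon> * A i j)"
  have mv: "mat_vec d (\<lambda>i j. mat_id d i j + \<epsilon> * A i j) v = (\<lambda>i. v i + \<epsilon> * mat_vec d A v i)"
    if "v \<in> vspace d" for \<epsilon> v
  proof
    fix i
    have "(\<Sum>j<d. mat_id d i j * v j) = v i" if "i < d"
      using that by (simp add: mat_id_def if_distrib[of "\<lambda>x. x * _"] cong: if_cong)
    then show "mat_vec d (\<lambda>i j. mat_id d i j + \<epsilon> * A i j) v i = v i + \<epsilon> * mat_vec d A v i"
      using that by (auto simp: mat_vec_def vspace_def distrib_right sum.distrib sum_distrib_left mult.assoc)
  qed
  have mono: "g A e \<le> g A e'" if e: "0 < e" "e \<le> e'" for e e'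
  proof -
    \<comment> \<open>I + e A is the convex combination of I and I + e' A with weights 1 - s and
      s.\<close>
    define s where "s = e / e'"
    have s: "0 < s" "s \<le> 1" "e = s * e'" using e by (auto simp: s_def)
    have "?I e \<le> (1 - s) + s * ?I e'"
    proof (rule induced_norm_le)
      fix v assume v: "v \<in> vspace d" "?n v = 1"
      have "mat_vec d (\<lambda>i j. mat_id d i j + e * A i j) v
          = (\<lambda>i. (1 - s) * v i + s * mat_vec d (\<lambda>i j. mat_id d i j + e' * A i j) v i)"
        by (simp only: mv[OF v(1)]) (simp add: s(3) algebra_simps)
      then have "?n (mat_vec d (\<lambda>i j. mat_id d i j + e * A i j) v)
          \<le> ?n (\<lambda>i. (1 - s) * v i) + ?n (\<lambda>i. s * mat_vec d (\<lambda>i j. mat_id d i j + e' * A i j) v i)"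
        using lp_norm_triangle[OF assms(1)] by simp
      also have "\<dots> = (1 - s) + s * ?n (mat_vec d (\<lambda>i j. mat_id d i j + e' * A i j) v)"
        using s v by (simp add: lp_norm_scale[OF assms(1)])
      also have "\<dots> \<le> (1 - s) + s * ?I e'"
        using lp_norm_mat_vec_le[OF assms(1), of d "\<lambda>i j. mat_id d i j + e' * A i j" v] v s by simp
      finally show "?n (mat_vec d (\<lambda>i j. mat_id d i j + e * A i j) v) \<le> (1 - s) + s * ?I e'" .
    qed (rule ex_unit_lp_norm[OF assms(1,2)])
    then have "?I e - 1 \<le> s * (?I e' - 1)" by (simp add: algebra_simps)
    then have "(?I e - 1) / e \<le> s * (?I e' - 1) / e" using e by (intro divide_right_mono) auto
    also have "\<dots> = (?I e' - 1) / e'" using e by (simp add: s_def)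
    finally show ?thesis by (simp add: g_def)
  qed
  obtain v where v: "v \<in> vspace d" "?n v = 1" using ex_unit_lp_norm[OF assms(1,2)] by blast
  \<comment> \<open>Reverse triangle inequality at one fixed unit vector: ||I + e A|| >= 1 - e |A
    v|.\<close>
  have lower: "- ?n (mat_vec d A v) \<le> g A e" if "e > 0" for e
  proof -
    have "?n v \<le> ?n (\<lambda>i. v i + e * mat_vec d A v i) + ?n (\<lambda>i. (- e) * mat_vec d A v i)"
      using lp_norm_triangle[OF assms(1), of d "\<lambda>i. v i + e * mat_vec d A v i" "\<lambda>i. (- e) * mat_vec d A v i"]
      by simp
    also have "\<dots> \<le> ?I e + e * ?n (mat_vec d A v)"
      using lp_norm_mat_vec_le[OF assms(1), of d "\<lambda>i j. mat_id d i j + e * A i j" v] v that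
      by (simp only: mv[OF v(1)] lp_norm_scale[OF assms(1)])
    finally show ?thesis using v that unfolding g_def by (simp add: field_simps)
  qed
  define L where "L = Inf (g A ` {0<..})"
  have bdd: "bdd_below (g A ` {0<..})" using lower by (intro bdd_belowI2) auto
  have "(g A \<longlongrightarrow> L) (at_right 0)"
  proof (rule order_tendstoI)
    fix y assume "y < L"
    have "eventually (\<lambda>e::real. e > 0) (at_right 0)" by (rule eventually_at_right_less)
    then show "\<forall>\<^sub>F e in at_right 0. y < g A e"
    proof eventually_elim
      case (elim e)
      then have "L \<le> g A e" unfolding L_def using bdd by (intro cInf_lower) auto
      then show ?case using \<open>y < L\<close> by simp
    qed
  next
    fix y assume "L < y"
    then have "\<exists>x\<in>g A ` {0<..}. x < y"
      unfolding L_def by (intro cInf_lessD) auto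
    then obtain e' where e': "e' > 0" "g A e' < y" by auto
    have "\<forall>\<^sub>F e in at_right 0. e < e'" using e' eventually_at_right_field by blast
    then show "\<forall>\<^sub>F e in at_right 0. g A e < y" using eventually_at_right_less[of 0]
    proof eventually_elim
      case (elim e)
      then show ?case using mono[of e e'] e' by simp
    qed
  qed
  moreover from this have "Lim (at_right 0) (g A) = L" by (intro tendsto_Lim) auto
  ultimately show ?thesis unfolding matrix_measure_def g_def by simp
qed


section \<open>Minors as alternating functions\<close>

lemma detn_cong:
  assumes "\<And>a b. a < k \<Longrightarrow> b < k \<Longrightarrow> A a b = B a b"
  shows "detn k A = detn k B"
proof -
  have "p i < k" if "p permutes {..<k}" "i < k" for p i
    using permutes_in_image[OF that(1), of i] that(2) by simp
  then show ?thesis unfolding detn_def using assms by (auto intro!: sum.cong prod.cong)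
qed

text \<open>Splitting off the factor from row \<open>a\<close> shows the determinant as a linear
  form in that row; multilinearity and the product rule are both read off from it.\<close>

lemma detn_upd_row:
  assumes "a < k"
  shows "detn k (A(a := X)) =
    (\<Sum>p | p permutes {..<k}. of_int (sign p) * (X (p a) * (\<Prod>i\<in>{..<k} - {a}. A i (p i))))"
proof -
  have "(\<Prod>i<k. (A(a := X)) i (p i)) = X (p a) * (\<Prod>i\<in>{..<k} - {a}. A i (p i))" for p
    using assms by (subst prod.remove[of _ a]) (auto intro!: prod.cong)
  then show ?thesis unfolding detn_def by simp
qed

lemma detn_upd_row_sum:
  assumes "a < k"
  shows "detn k (A(a := \<lambda>b. \<Sum>l\<in>S. c l * R l b)) = (\<Sum>l\<in>S. c l * detn k (A(a := R l)))"
  unfolding detn_upd_row[OF assms] sum_distrib_left sum_distrib_right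
  by (subst sum.swap) (simp add: mult_ac)

lemma detn_swap_rows:
  assumes "a < k" "b < k" "a \<noteq> b"
  shows "detn k (\<lambda>i. A (Transposition.transpose a b i)) = - detn k A"
proof -
  let ?t = "Transposition.transpose a b"
  have t: "?t permutes {..<k}" using assms by (intro permutes_swap_id) auto
  have "(\<Prod>i<k. A (?t i) (p i)) = (\<Prod>i<k. A i ((p \<circ> ?t) i))" for p
    using prod.permute[OF t, of "\<lambda>i. A (?t i) (p i)"] by (simp add: o_def)
  moreover have "sign p = - sign (p \<circ> ?t)" if "p permutes {..<k}" for p
  proof -
    have "permutation p" using that permutation_permutes by blast
    then show ?thesis
      using sign_compose[of p ?t] assms(3) by (simp add: permutation_swap_id sign_swap_id)
  qed
  ultimately have "detn k (\<lambda>i. A (?t i)) =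
      (\<Sum>p | p permutes {..<k}. - (of_int (sign (p \<circ> ?t)) * (\<Prod>i<k. A i ((p \<circ> ?t) i))))"
    unfolding detn_def by (intro sum.cong) auto
  also have "\<dots> = - detn k A"
    unfolding detn_def sum_negf
    using sum_permutations_compose_right[OF t, of "\<lambda>p. of_int (sign p) * (\<Prod>i<k. A i (p i))"] by simp
  finally show ?thesis .
qed

lemma has_field_derivative_prod_within:
  fixes f :: "'i \<Rightarrow> real \<Rightarrow> real"
  assumes "\<And>i. i \<in> I \<Longrightarrow> (f i has_field_derivative f' i) (at x within S)"
  shows "((\<lambda>y. \<Prod>i\<in>I. f i y) has_field_derivative (\<Sum>i\<in>I. f' i * (\<Prod>j\<in>I - {i}. f j x))) (at x within S)"
proof -
  have "((\<lambda>y. \<Prod>i\<in>I. f i y) has_derivative (\<lambda>y. \<Sum>i\<in>I. f' i * y * (\<Prod>j\<in>I - {i}. f j x))) (at x within S)"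
    using assms unfolding has_field_derivative_def by (rule has_derivative_prod)
  then show ?thesis
    unfolding has_field_derivative_def by (rule has_derivative_eq_rhs) (auto simp: fun_eq_iff sum_distrib_left mult_ac)
qed

text \<open>Rows rather than columns are differentiated because \<Phi>' = J \<Phi> makes each row of
  the derivative a combination of rows of \<Phi>. Derivatives within a set are used since at time 0
  only the right-hand derivative is given.\<close>

lemma has_field_derivative_detn:
  fixes A :: "real \<Rightarrow> nmat"
  assumes "\<And>a b. a < k \<Longrightarrow> b < k \<Longrightarrow> ((\<lambda>t. A t a b) has_field_derivative A' a b) (at t within S)"
  shows "((\<lambda>t. detn k (A t)) has_field_derivative (\<Sum>a<k. detn k ((A t)(a := A' a)))) (at t within S)"
proof -
  have "p i < k" if "p permutes {..<k}" "i < k" for p i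
    using permutes_in_image[OF that(1), of i] that(2) by simp
  then have "((\<lambda>t. detn k (A t)) has_field_derivative
      (\<Sum>p | p permutes {..<k}. of_int (sign p) *
        (\<Sum>a<k. A' a (p a) * (\<Prod>i\<in>{..<k} - {a}. A t i (p i))))) (at t within S)"
    unfolding detn_def using assms
    by (intro DERIV_sum DERIV_cmult has_field_derivative_prod_within) auto
  also have "(\<Sum>p | p permutes {..<k}. of_int (sign p) *
        (\<Sum>a<k. A' a (p a) * (\<Prod>i\<in>{..<k} - {a}. A t i (p i)))) = (\<Sum>a<k. detn k ((A t)(a := A' a)))"
    unfolding sum_distrib_left by (subst sum.swap) (simp add: detn_upd_row)
  finally show ?thesis .
qed

lemma detn_kronecker: "detn k (\<lambda>a b. if a = b then 1 else 0) = 1"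
proof -
  have "(\<Prod>i<k. if i = p i then 1 else 0) = (if p = id then 1 else 0 :: real)" if "p permutes {..<k}" for p
  proof (cases "p = id")
    case False
    then obtain i where "i \<noteq> p i" by fastforce
    moreover from this have "i < k" using that by (metis lessThan_iff permutes_not_in)
    ultimately have "\<exists>i\<in>{..<k}. (if i = p i then 1 else 0 :: real) = 0" by (intro bexI[of _ i]) auto
    then show ?thesis using False by (simp only: prod_zero[OF finite_lessThan] if_False)
  qed simp
  then have "detn k (\<lambda>a b. if a = b then 1 else 0) =
      (\<Sum>p | p permutes {..<k}. if p = id then of_int (sign p) else 0)"
    unfolding detn_def by (intro sum.cong) auto
  also have "\<dots> = 1" by (simp add: finite_permutations permutes_id[unfolded id_def[symmetric]])
  finally show ?thesis .
qed

section \<open>Increasing tuples and their enumeration\<close>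

definition inc_lists :: "nat \<Rightarrow> nat \<Rightarrow> nat list set" where
  "inc_lists d k = {xs. sorted_wrt (<) xs \<and> length xs = k \<and> set xs \<subseteq> {..<d}}"

lemma finite_inc_lists: "finite (inc_lists d k)"
  by (rule finite_subset[OF _ finite_lists_length_eq[of "{..<d}" k]]) (auto simp: inc_lists_def)

lemma sort_in_inc_lists:
  "distinct xs \<Longrightarrow> length xs = k \<Longrightarrow> set xs \<subseteq> {..<d} \<Longrightarrow> sort xs \<in> inc_lists d k"
  by (simp add: inc_lists_def strict_sorted_iff)

lemma inc_lists_eqI: "xs \<in> inc_lists d k \<Longrightarrow> ys \<in> inc_lists d k \<Longrightarrow> set xs = set ys \<Longrightarrow> xs = ys"
  by (auto simp: inc_lists_def intro: strict_sorted_equal)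

lemma card_inc_lists: "card (inc_lists d k) = d choose k"
proof -
  have "bij_betw set (inc_lists d k) {S. S \<subseteq> {..<d} \<and> card S = k}"
    unfolding bij_betw_def
  proof
    show "inj_on set (inc_lists d k)" by (auto simp: inj_on_def intro: inc_lists_eqI)
    show "set ` inc_lists d k = {S. S \<subseteq> {..<d} \<and> card S = k}"
    proof (intro equalityI subsetI)
      fix S assume "S \<in> {S. S \<subseteq> {..<d} \<and> card S = k}"
      then have "S \<subseteq> {..<d}" "card S = k" "finite S" by (auto intro: finite_subset)
      then show "S \<in> set ` inc_lists d k"
        by (intro image_eqI[of _ _ "sorted_list_of_set S"])
          (auto simp: inc_lists_def)
    qed (auto simp: inc_lists_def strict_sorted_iff distinct_card)
  qed
  then show ?thesis using n_subsets[of "{..<d}" k] by (simp add: bij_betw_same_card)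
qed

lemma ktuples_inc_lists:
  shows set_ktuples: "set (ktuples d k) = inc_lists d k"
    and distinct_ktuples: "distinct (ktuples d k)"
    and length_ktuples: "length (ktuples d k) = d choose k"
proof -
  have *: "ktuples d k = sorted_list_of_set (inc_lists d k)" by (simp add: ktuples_def inc_lists_def)
  show "set (ktuples d k) = inc_lists d k" "distinct (ktuples d k)" "length (ktuples d k) = d choose k"
    by (simp_all add: * finite_inc_lists card_inc_lists)
qed

lemma ktuples_nth: "i < d choose k \<Longrightarrow> ktuples d k ! i \<in> inc_lists d k"
  by (metis set_ktuples length_ktuples nth_mem)

lemma ktuples_ex_nth: "xs \<in> inc_lists d k \<Longrightarrow> \<exists>i<d choose k. ktuples d k ! i = xs"
  by (metis set_ktuples length_ktuples in_set_conv_nth)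

lemma ktuples_nth_eq_iff:
  "i < d choose k \<Longrightarrow> j < d choose k \<Longrightarrow> ktuples d k ! i = ktuples d k ! j \<longleftrightarrow> i = j"
  by (simp add: distinct_ktuples length_ktuples nth_eq_iff_index_eq)

text \<open>Passing from indices to the set of increasing tuples removes the lexicographic order
  from all later sums.\<close>

lemma sum_ktuples: "(\<Sum>i<d choose k. f (ktuples d k ! i)) = (\<Sum>xs\<in>inc_lists d k. f xs)"
proof -
  have "bij_betw ((!) (ktuples d k)) {..<d choose k} (inc_lists d k)"
    by (intro bij_betw_nth) (simp_all add: distinct_ktuples length_ktuples set_ktuples)
  then show ?thesis by (rule sum.reindex_bij_betw)
qed

section \<open>Alternating functions of tuples\<close>

definition alternating :: "nat \<Rightarrow> ('a list \<Rightarrow> real) \<Rightarrow> bool" where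
  "alternating k Y \<longleftrightarrow> (\<forall>xs a b. length xs = k \<longrightarrow> a < k \<longrightarrow> b < k \<longrightarrow> a \<noteq> b
     \<longrightarrow> Y (xs[a := xs ! b, b := xs ! a]) = - Y xs)"

lemma permute_list_transpose:
  "a < length xs \<Longrightarrow> b < length xs \<Longrightarrow>
    permute_list (Transposition.transpose a b) xs = xs[a := xs ! b, b := xs ! a]"
  by (rule nth_equalityI)
    (auto simp: permute_list_nth permutes_swap_id transpose_def nth_list_update)

lemma alternating_permute:
  assumes "alternating k Y" "p permutes {..<k}" "length xs = k"
  shows "Y (permute_list p xs) = of_int (sign p) * Y xs"
  using assms(2) finite_lessThan assms(3)
proof (induction arbitrary: xs rule: permutes_induct)
  case id
  then show ?case by simp
next
  case (swap a b p)
  let ?t = "Transposition.transpose a b"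
  have "Y (permute_list (?t \<circ> p) xs) = Y (permute_list p (permute_list ?t xs))"
    using swap by (simp add: permute_list_compose)
  also have "\<dots> = of_int (sign p) * Y (permute_list ?t xs)" using swap by simp
  also have "Y (permute_list ?t xs) = - Y xs"
    using assms(1) swap unfolding alternating_def by (simp add: permute_list_transpose)
  also have "of_int (sign p) * - Y xs = of_int (sign (?t \<circ> p)) * Y xs"
    using swap permutation_permutes[of p]
    by (subst sign_compose) (auto simp: permutation_swap_id sign_swap_id)
  finally show ?case .
qed

text \<open>Exchanging two equal entries fixes the tuple but reverses the sign of the value.\<close>

lemma alternating_eq_0:
  assumes "alternating k Y" "length xs = k" "\<not> distinct xs"
  shows "Y xs = 0"
proof -
  obtain a b where ab: "a < k" "b < k" "a \<noteq> b" "xs ! a = xs ! b"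
    using assms by (auto simp: distinct_conv_nth)
  then have "xs[a := xs ! b, b := xs ! a] = xs" by (metis list_update_id)
  then show ?thesis using assms ab unfolding alternating_def by (metis equal_neg_zero)
qed

lemma alternating_sort:
  fixes xs :: "nat list"
  assumes "alternating k Y" "length xs = k"
  obtains p where "p permutes {..<k}" "permute_list p (sort xs) = xs" "Y xs = of_int (sign p) * Y (sort xs)"
proof -
  obtain p where "p permutes {..<length (sort xs)}" "permute_list p (sort xs) = xs"
    using mset_eq_permutation[of xs "sort xs"] by auto
  then show ?thesis using that alternating_permute[OF assms(1), of p "sort xs"] assms(2) by simp
qed

lemma alternating_detn: "alternating k (\<lambda>xs. detn k (\<lambda>a. f (xs ! a)))"
  unfolding alternating_def
proof (intro allI impI)
  fix xs :: "'a list" and a b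
  assume *: "length xs = k" "a < k" "b < k" "a \<noteq> b"
  have "detn k (\<lambda>i. f (xs[a := xs ! b, b := xs ! a] ! i)) = detn k (\<lambda>i. f (xs ! Transposition.transpose a b i))"
    using * by (intro detn_cong) (auto simp: transpose_def nth_list_update)
  then show "detn k (\<lambda>i. f (xs[a := xs ! b, b := xs ! a] ! i)) = - detn k (\<lambda>a. f (xs ! a))"
    using detn_swap_rows[OF *(2-), of "\<lambda>i. f (xs ! i)"] by simp
qed

lemma alternating_sum:
  assumes "\<And>j. j \<in> S \<Longrightarrow> alternating k (Y j)" shows "alternating k (\<lambda>xs. \<Sum>j\<in>S. c j * Y j xs)"
  using assms unfolding alternating_def by (simp add: sum_negf)

text \<open>If I and J differ, equal cardinality leaves an index of I outside J, and its row of the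
  submatrix vanishes. So the compound of the identity is the identity.\<close>

lemma detn_mat_id_inc_lists:
  assumes "I \<in> inc_lists d k" "J \<in> inc_lists d k"
  shows "detn k (\<lambda>a b. mat_id d (I ! a) (J ! b)) = (if I = J then 1 else 0)"
proof (cases "I = J")
  case True
  have "distinct I" using assms by (simp add: inc_lists_def strict_sorted_iff)
  then have "detn k (\<lambda>a b. mat_id d (I ! a) (J ! b)) = detn k (\<lambda>a b. if a = b then 1 else 0)"
    using assms True by (intro detn_cong) (auto simp: inc_lists_def mat_id_def nth_eq_iff_index_eq subset_iff)
  then show ?thesis using True detn_kronecker by simp
next
  case False
  have "card (set I) = card (set J)"
    using assms by (simp add: inc_lists_def strict_sorted_iff distinct_card)
  then have "\<not> set I \<subseteq> set J" using inc_lists_eqI[OF assms] False card_subset_eq[of "set J" "set I"] by auto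
  then obtain a where a: "a < k" "I ! a \<notin> set J"
    using assms by (auto simp: inc_lists_def in_set_conv_nth subset_iff)
  have "(\<Prod>i<k. mat_id d (I ! i) (J ! p i)) = 0" if "p permutes {..<k}" for p
  proof (rule prod_zero)
    have "p a < k" using permutes_in_image[OF that, of a] a by simp
    then have "J ! p a \<in> set J" using assms by (simp add: inc_lists_def)
    then show "\<exists>i\<in>{..<k}. mat_id d (I ! i) (J ! p i) = 0"
      using a by (intro bexI[of _ a]) (auto simp: mat_id_def)
  qed simp
  then have "detn k (\<lambda>a b. mat_id d (I ! a) (J ! b)) = (\<Sum>p | p permutes {..<k}. of_int (sign p) * 0)"
    unfolding detn_def by (intro sum.cong) auto
  then show ?thesis using False by simp
qed

text \<open>A minor of the identity is nonzero only when \<open>J\<close> is the sorted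
  \<open>xs\<close>, where it is the sign of the sorting permutation; for a tuple with a repetition
  all of them vanish. The minors thus do the sign bookkeeping.\<close>

lemma alternating_expand:
  assumes "alternating k Y" "length xs = k" "set xs \<subseteq> {..<d}"
  shows "(\<Sum>J\<in>inc_lists d k. detn k (\<lambda>a b. mat_id d (xs ! a) (J ! b)) * Y J) = Y xs"
proof (cases "distinct xs")
  case False
  have "detn k (\<lambda>a b. mat_id d (xs ! a) (J ! b)) = 0" for J
    by (rule alternating_eq_0[OF alternating_detn[of k "\<lambda>x b. mat_id d x (J ! b)"] assms(2) False])
  then show ?thesis using alternating_eq_0[OF assms(1,2) False] by simp
next
  case True
  let ?I = "sort xs"
  have I: "?I \<in> inc_lists d k" using sort_in_inc_lists True assms by blast
  obtain p where p: "p permutes {..<k}" "permute_list p ?I = xs" "Y xs = of_int (sign p) * Y ?I"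
    using alternating_sort[OF assms(1,2)] .
  have "detn k (\<lambda>a b. mat_id d (xs ! a) (J ! b)) = of_int (sign p) * (if ?I = J then 1 else 0)"
    if "J \<in> inc_lists d k" for J
    using alternating_permute[OF alternating_detn[of k "\<lambda>x b. mat_id d x (J ! b)"] p(1), of ?I]
      assms(2) by (simp add: p(2) detn_mat_id_inc_lists[OF I that])
  then have "(\<Sum>J\<in>inc_lists d k. detn k (\<lambda>a b. mat_id d (xs ! a) (J ! b)) * Y J)
      = (\<Sum>J\<in>inc_lists d k. if ?I = J then of_int (sign p) * Y J else 0)"
    by (intro sum.cong) auto
  also have "\<dots> = Y xs" using I p(3) by (simp add: finite_inc_lists)
  finally show ?thesis .
qed


section \<open>Compound matrices\<close>

lemma mat_pow_0: "mat_pow d A 0 = mat_id d"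
  by (simp add: mat_pow_def)

lemma mat_pow_Suc: "mat_pow d A (Suc l) = mat_mult d A (mat_pow d A l)"
  by (simp add: mat_pow_def)

lemma mat_pow_1: "j < d \<Longrightarrow> mat_pow d A (Suc 0) i j = A i j"
  by (simp add: mat_pow_0 mat_pow_Suc mat_mult_def mat_id_def if_distrib cong: if_cong)

lemma mat_pow_scale: "mat_pow d (\<lambda>a b. t * A a b) l i j = t ^ l * mat_pow d A l i j"
  by (induction l arbitrary: i j)
    (simp_all add: mat_pow_0 mat_pow_Suc mat_mult_def sum_distrib_left mult_ac)

text \<open>The sum of all absolute entries acts as a submultiplicative bound, which makes the
  exponential series converge for every \<open>t\<close>.\<close>

lemma abs_mat_pow_le:
  assumes "i < d" shows "\<bar>mat_pow d A l i j\<bar> \<le> (\<Sum>a<d. \<Sum>b<d. \<bar>A a b\<bar>) ^ l"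
  using assms
proof (induction l arbitrary: i)
  case 0
  then show ?case by (simp add: mat_pow_0 mat_id_def)
next
  case (Suc l)
  let ?c = "\<Sum>a<d. \<Sum>b<d. \<bar>A a b\<bar>"
  have "\<bar>mat_pow d A (Suc l) i j\<bar> \<le> (\<Sum>b<d. \<bar>A i b * mat_pow d A l b j\<bar>)"
    unfolding mat_pow_Suc mat_mult_def by (rule sum_abs)
  also have "\<dots> \<le> (\<Sum>b<d. \<bar>A i b\<bar> * ?c ^ l)"
    using Suc.IH by (intro sum_mono) (auto simp: abs_mult intro!: mult_left_mono)
  also have "\<dots> = (\<Sum>b<d. \<bar>A i b\<bar>) * ?c ^ l" by (simp add: sum_distrib_right)
  also have "\<dots> \<le> ?c * ?c ^ l"
    using Suc.prems by (intro mult_right_mono member_le_sum[of i "{..<d}" "\<lambda>a. \<Sum>b<d. \<bar>A a b\<bar>"])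
      (auto intro!: sum_nonneg zero_le_power)
  finally show ?case by simp
qed

lemma mat_exp_power_series:
  "mat_exp d (\<lambda>a b. t * A a b) i j = (\<Sum>l. (mat_pow d A l i j / fact l) * t ^ l)"
  by (simp add: mat_exp_def mat_pow_scale mult_ac)

lemma mat_exp_at_0: "mat_exp d (\<lambda>a b. 0) i j = mat_id d i j"
  using mat_exp_power_series[of d 0 "\<lambda>_ _. 0" i j]
    powser_zero[of "\<lambda>l. mat_pow d (\<lambda>_ _. 0) l i j / fact l"] by (simp add: mat_pow_0)

lemma mat_exp_deriv_at_0:
  assumes "i < d" "j < d"
  shows "((\<lambda>t. mat_exp d (\<lambda>a b. t * A a b) i j) has_field_derivative A i j) (at 0)"
proof -
  let ?c = "\<Sum>a<d. \<Sum>b<d. \<bar>A a b\<bar>" and ?q = "\<lambda>l. mat_pow d A l i j / fact l"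
  have "summable (\<lambda>l. ?q l * t ^ l)" for t :: real
  proof (rule summable_comparison_test')
    show "summable (\<lambda>l. inverse (fact l) * (?c * \<bar>t\<bar>) ^ l)" by (rule summable_exp)
    show "norm (?q l * t ^ l) \<le> inverse (fact l) * (?c * \<bar>t\<bar>) ^ l" for l
      using abs_mat_pow_le[OF assms(1), of A l j]
      by (simp add: abs_mult power_mult_distrib power_abs divide_simps mult_right_mono)
  qed
  then have "((\<lambda>t. \<Sum>l. ?q l * t ^ l) has_field_derivative (\<Sum>l. diffs ?q l * 0 ^ l)) (at 0)"
    by (rule termdiffs_strong_converges_everywhere)
  \<comment> \<open>At 0 only the constant term of the differentiated series survives, which is the
    coefficient of the first power.\<close>
  also have "(\<Sum>l. diffs ?q l * 0 ^ l) = A i j"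
    unfolding powser_zero using assms mat_pow_1 by (simp add: diffs_def)
  finally show ?thesis by (simp add: mat_exp_power_series)
qed

text \<open>Differentiating the minors of exp(t A) at 0 replaces, one at a time, row x_a of the
  identity by row x_a of A. The additive compound therefore acts as a derivation, and no formula for
  its entries is required. For k = 0 both sides are 0, in agreement with the convention M^[0] =
  0.\<close>

lemma add_compound_apply:
  assumes Z: "alternating k Z" and I: "I < d choose k"
  defines "x \<equiv> ktuples d k ! I"
  shows "(\<Sum>J<d choose k. add_compound d k A I J * Z (ktuples d k ! J)) =
    (\<Sum>a<k. \<Sum>l<d. A (x ! a) l * Z (x[a := l]))"
proof -
  have x: "length x = k" "set x \<subseteq> {..<d}" using ktuples_nth[OF I] by (auto simp: inc_lists_def x_def)
  have xa: "x ! a < d" if "a < k" for a using x that by (metis lessThan_iff nth_mem subsetD)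
  have "add_compound d k A I J =
      (\<Sum>a<k. \<Sum>l<d. A (x ! a) l * detn k (\<lambda>a' b. mat_id d (x[a := l] ! a') (ktuples d k ! J ! b)))"
    if J: "J < d choose k" for J
  proof -
    let ?y = "ktuples d k ! J"
    have y: "?y ! b < d" if "b < k" for b
      using ktuples_nth[OF J] that by (auto simp: inc_lists_def subset_iff)
    have "((\<lambda>t. detn k (\<lambda>a b. mat_exp d (\<lambda>a b. t * A a b) (x ! a) (?y ! b))) has_field_derivative
        (\<Sum>a<k. detn k ((\<lambda>a b. mat_exp d (\<lambda>a b. 0 * A a b) (x ! a) (?y ! b))(a := \<lambda>b. A (x ! a) (?y ! b))))) (at 0)"
      by (intro has_field_derivative_detn mat_exp_deriv_at_0 xa y)
    then have "add_compound d k A I J =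
        (\<Sum>a<k. detn k ((\<lambda>a b. mat_id d (x ! a) (?y ! b))(a := \<lambda>b. A (x ! a) (?y ! b))))"
      using I J unfolding add_compound_def mult_compound_def x_def
      by (simp add: DERIV_imp_deriv mat_exp_at_0)
    also have "\<dots> = (\<Sum>a<k. \<Sum>l<d. A (x ! a) l * detn k (\<lambda>a' b. mat_id d (x[a := l] ! a') (?y ! b)))"
    proof (rule sum.cong[OF refl])
      fix a assume "a \<in> {..<k}"
      then have a: "a < k" by simp
      \<comment> \<open>Row x_a of \<open>A\<close> is expanded in the rows of the identity, so that
        linearity in this row trades it for replaced entries of the tuple.\<close>
      have "detn k ((\<lambda>a b. mat_id d (x ! a) (?y ! b))(a := \<lambda>b. A (x ! a) (?y ! b)))
          = detn k ((\<lambda>a b. mat_id d (x ! a) (?y ! b))(a := \<lambda>b. \<Sum>l<d. A (x ! a) l * mat_id d l (?y ! b)))"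
        using y by (intro detn_cong) (auto simp: mat_id_def if_distrib cong: if_cong)
      also have "\<dots> = (\<Sum>l<d. A (x ! a) l *
          detn k ((\<lambda>a b. mat_id d (x ! a) (?y ! b))(a := \<lambda>b. mat_id d l (?y ! b))))"
        by (rule detn_upd_row_sum[OF a])
      also have "\<dots> = (\<Sum>l<d. A (x ! a) l * detn k (\<lambda>a' b. mat_id d (x[a := l] ! a') (?y ! b)))"
        using x a by (intro sum.cong refl arg_cong2[where f="(*)"] detn_cong) (auto simp: nth_list_update)
      finally show "detn k ((\<lambda>a b. mat_id d (x ! a) (?y ! b))(a := \<lambda>b. A (x ! a) (?y ! b))) =
        (\<Sum>l<d. A (x ! a) l * detn k (\<lambda>a' b. mat_id d (x[a := l] ! a') (?y ! b)))" .
    qed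
    finally show ?thesis .
  qed
  then have "(\<Sum>J<d choose k. add_compound d k A I J * Z (ktuples d k ! J)) =
      (\<Sum>J<d choose k. \<Sum>a<k. \<Sum>l<d. A (x ! a) l *
        (detn k (\<lambda>a' b. mat_id d (x[a := l] ! a') (ktuples d k ! J ! b)) * Z (ktuples d k ! J)))"
    by (simp add: sum_distrib_left mult_ac)
  also have "\<dots> = (\<Sum>a<k. \<Sum>l<d. A (x ! a) l * (\<Sum>J<d choose k.
        detn k (\<lambda>a' b. mat_id d (x[a := l] ! a') (ktuples d k ! J ! b)) * Z (ktuples d k ! J)))"
    by (subst sum.swap, rule sum.cong[OF refl], subst sum.swap) (simp add: sum_distrib_left)
  \<comment> \<open>Summing over \<open>J\<close> recovers \<open>Z\<close> at the modified tuple,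
    sorted or not.\<close>
  also have "\<dots> = (\<Sum>a<k. \<Sum>l<d. A (x ! a) l * Z (x[a := l]))"
  proof (intro sum.cong refl arg_cong2[where f="(*)"])
    fix a l assume "a \<in> {..<k}" "l \<in> {..<d}"
    then have "length (x[a := l]) = k" "set (x[a := l]) \<subseteq> {..<d}"
      using x set_update_subset_insert[of x a l] by auto
    then show "(\<Sum>J<d choose k. detn k (\<lambda>a' b. mat_id d (x[a := l] ! a') (ktuples d k ! J ! b)) * Z (ktuples d k ! J))
        = Z (x[a := l])"
      using alternating_expand[OF Z, of "x[a := l]" d] by (simp add: sum_ktuples[where f="\<lambda>J. detn k (\<lambda>a' b. mat_id d (x[a := l] ! a') (J ! b)) * Z J"])
  qed
  finally show ?thesis .
qed

text \<open>
  \<open>tensor d k v M\<close> extends the coordinates of \<open>M\<^sup>(\<^sup>k\<^sup>) v\<close> from increasing to arbitrary tuples.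
\<close>

definition tensor :: "nat \<Rightarrow> nat \<Rightarrow> (nat \<Rightarrow> real) \<Rightarrow> nmat \<Rightarrow> nat list \<Rightarrow> real" where
  "tensor d k v M xs = (\<Sum>J<d choose k. v J * detn k (\<lambda>a b. M (xs ! a) (ktuples d k ! J ! b)))"

lemma alternating_tensor: "alternating k (tensor d k v M)"
  unfolding tensor_def[abs_def] by (intro alternating_sum alternating_detn)

lemma tensor_cong:
  assumes "\<And>i j. i < d \<Longrightarrow> j < d \<Longrightarrow> M i j = M' i j" "length xs = k" "set xs \<subseteq> {..<d}"
  shows "tensor d k v M xs = tensor d k v M' xs"
proof -
  have "ktuples d k ! J ! b < d" if "J < d choose k" "b < k" for J b
    using ktuples_nth[OF that(1)] that(2) by (auto simp: inc_lists_def subset_iff)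
  moreover have "xs ! a < d" if "a < k" for a
    using assms(2,3) that by (metis lessThan_iff nth_mem subsetD)
  ultimately show ?thesis
    unfolding tensor_def using assms(1) by (intro sum.cong refl arg_cong2[where f="(*)"] detn_cong) auto
qed

text \<open>This is the compound equation (\<Phi>^(k))' = J^[k] \<Phi>^(k) with J^[k] in its
  derivation form, so the additive compound of the full Jacobian is never formed.\<close>

lemma has_field_derivative_tensor:
  assumes "\<And>i j. i < d \<Longrightarrow> j < d \<Longrightarrow>
      ((\<lambda>t. \<Phi> t i j) has_field_derivative (\<Sum>l<d. A i l * \<Phi> t l j)) (at t within S)"
    and xs: "length xs = k" "set xs \<subseteq> {..<d}"
  shows "((\<lambda>t. tensor d k v (\<Phi> t) xs) has_field_derivative
    (\<Sum>a<k. \<Sum>l<d. A (xs ! a) l * tensor d k v (\<Phi> t) (xs[a := l]))) (at t within S)"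
proof -
  let ?y = "\<lambda>J. ktuples d k ! J"
  have y: "?y J ! b < d" if "J < d choose k" "b < k" for J b
    using ktuples_nth[OF that(1)] that(2) by (auto simp: inc_lists_def subset_iff)
  have xa: "xs ! a < d" if "a < k" for a
    using xs that by (metis lessThan_iff nth_mem subsetD)
  let ?D = "\<lambda>J a. detn k ((\<lambda>a b. \<Phi> t (xs ! a) (?y J ! b))(a := \<lambda>b. \<Sum>l<d. A (xs ! a) l * \<Phi> t l (?y J ! b)))"
  have "((\<lambda>t. tensor d k v (\<Phi> t) xs) has_field_derivative
      (\<Sum>J<d choose k. v J * (\<Sum>a<k. ?D J a))) (at t within S)"
    unfolding tensor_def by (intro DERIV_sum DERIV_cmult has_field_derivative_detn assms(1) xa y) auto
  moreover have "?D J a = (\<Sum>l<d. A (xs ! a) l * detn k (\<lambda>a' b. \<Phi> t (xs[a := l] ! a') (?y J ! b)))"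
    if a: "a < k" for J a
    unfolding detn_upd_row_sum[OF a]
    using xs(1) a by (intro sum.cong refl arg_cong2[where f="(*)"] detn_cong) (auto simp: nth_list_update)
  then have "(\<Sum>J<d choose k. v J * (\<Sum>a<k. ?D J a)) =
      (\<Sum>J<d choose k. \<Sum>a<k. \<Sum>l<d. A (xs ! a) l * (v J * detn k (\<lambda>a' b. \<Phi> t (xs[a := l] ! a') (?y J ! b))))"
    by (simp add: sum_distrib_left mult_ac)
  also have "\<dots> = (\<Sum>a<k. \<Sum>l<d. A (xs ! a) l * tensor d k v (\<Phi> t) (xs[a := l]))"
    unfolding tensor_def
    by (subst sum.swap, rule sum.cong[OF refl], subst sum.swap) (simp add: sum_distrib_left)
  ultimately show ?thesis by simp
qed

text \<open>The contraction norm reads a vector only through its extension by \<open>mat_id\<close>;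
  this identifies the extension of \<Phi>^(k) v with the function that satisfies the differential
  equation.\<close>

lemma tensor_mult_compound:
  assumes "length xs = k" "set xs \<subseteq> {..<d}"
  shows "tensor d k (mat_vec (d choose k) (mult_compound d d k M) v) (mat_id d) xs = tensor d k v M xs"
proof -
  have "mat_vec (d choose k) (mult_compound d d k M) v J = tensor d k v M (ktuples d k ! J)"
    if "J < d choose k" for J
    using that by (simp add: mat_vec_def mult_compound_def tensor_def mult.commute)
  then have "tensor d k (mat_vec (d choose k) (mult_compound d d k M) v) (mat_id d) xs =
     (\<Sum>J<d choose k. detn k (\<lambda>a b. mat_id d (xs ! a) (ktuples d k ! J ! b)) * tensor d k v M (ktuples d k ! J))"
    by (simp add: tensor_def[of d k "mat_vec _ _ _"] mult.commute)
  also have "\<dots> = tensor d k v M xs"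
    using alternating_expand[OF alternating_tensor assms, of d v M]
    by (simp add: sum_ktuples[where f="\<lambda>J. detn k (\<lambda>a b. mat_id d (xs ! a) (J ! b)) * tensor d k v M J"])
  finally show ?thesis .
qed

lemma tensor_mat_id_ktuples:
  assumes "I < d choose k" shows "tensor d k v (mat_id d) (ktuples d k ! I) = v I"
proof -
  have "tensor d k v (mat_id d) (ktuples d k ! I) = (\<Sum>J<d choose k. if J = I then v J else 0)"
    unfolding tensor_def using assms
    by (intro sum.cong) (auto simp: detn_mat_id_inc_lists ktuples_nth ktuples_nth_eq_iff)
  then show ?thesis using assms by simp
qed

lemma tensor_add: "tensor d k (\<lambda>i. v i + w i) M xs = tensor d k v M xs + tensor d k w M xs"
  by (simp add: tensor_def distrib_right sum.distrib)

lemma tensor_scale: "tensor d k (\<lambda>i. c * v i) M xs = c * tensor d k v M xs"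
  by (simp add: tensor_def sum_distrib_left mult_ac)


section \<open>Differential inequalities\<close>

text \<open>For each slope c > 0 the times in [0, T] at which w lies on or below the line w 0 + c t
  form a compact set. Its largest element cannot lie before T, because the increment bound leads to
  a later one. Then c tends to 0.\<close>

lemma dini_nonincreasing:
  fixes w :: "real \<Rightarrow> real"
  assumes cont: "continuous_on {0..} w"
    and dini: "\<And>t c. 0 \<le> t \<Longrightarrow> 0 < c \<Longrightarrow> \<forall>\<^sub>F e in at_right 0. w (t + e) \<le> w t + e * c"
    and T: "0 \<le> T"
  shows "w T \<le> w 0"
proof -
  have le: "w T \<le> w 0 + c * T" if c: "0 < c" for c
  proof -
    define S where "S = {t \<in> {0..T}. w t \<le> w 0 + c * t}"
    have "closed S" unfolding S_def
      by (intro continuous_closed_preimage_constant continuous_on_closed_Collect_le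
          continuous_intros continuous_on_subset[OF cont]) auto
    moreover have "bounded S" by (rule bounded_subset[of "{0..T}"]) (auto simp: S_def)
    ultimately have "compact S" by (simp add: compact_eq_bounded_closed)
    moreover have "S \<noteq> {}" using T by (auto simp: S_def intro!: exI[of _ 0])
    ultimately obtain s where s: "s \<in> S" "\<And>t. t \<in> S \<Longrightarrow> t \<le> s"
      using compact_attains_sup by metis
    have "s = T"
    proof (rule ccontr)
      assume "s \<noteq> T"
      then have lt: "0 < T - s" and s0: "0 \<le> s" using s by (auto simp: S_def)
      have "\<forall>\<^sub>F e in at_right 0. e < T - s" using lt eventually_at_right_field by blast
      then have "\<forall>\<^sub>F e in at_right 0. 0 < e \<and> e < T - s \<and> w (s + e) \<le> w s + e * c"
        using dini[OF s0 c] eventually_at_right_less[of 0] by eventually_elim auto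
      then obtain e where e: "0 < e" "e < T - s" "w (s + e) \<le> w s + e * c"
        using eventually_happens'[OF trivial_limit_at_right_real] by blast
      then have "s + e \<in> S" using s(1) by (auto simp: S_def algebra_simps)
      then show False using s(2) e(1) by fastforce
    qed
    then show ?thesis using s(1) by (simp add: S_def)
  qed
  show ?thesis
  proof (rule field_le_epsilon)
    fix e :: real assume "0 < e"
    \<comment> \<open>Dividing by T + 1 instead of T covers T = 0.\<close>
    have "w T \<le> w 0 + e / (T + 1) * T" using le[of "e / (T + 1)"] \<open>0 < e\<close> T by simp
    also have "e / (T + 1) * T \<le> e" using \<open>0 < e\<close> T by (simp add: field_simps)
    finally show "w T \<le> w 0 + e" by simp
  qed
qed

lemma dini_exponential_decay:
  fixes u :: "real \<Rightarrow> real"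
  assumes cont: "continuous_on {0..} u"
    and dini: "\<And>t c. 0 \<le> t \<Longrightarrow> - \<eta> * u t < c \<Longrightarrow> \<forall>\<^sub>F e in at_right 0. u (t + e) \<le> u t + e * c"
    and T: "0 \<le> T"
  shows "u T \<le> exp (- \<eta> * T) * u 0"
proof -
  define w where "w = (\<lambda>t. exp (\<eta> * t) * u t)"
  have "w T \<le> w 0"
  proof (rule dini_nonincreasing[OF _ _ T])
    show "continuous_on {0..} w" unfolding w_def by (intro continuous_intros cont)
  next
    fix t c :: real assume t: "0 \<le> t" and c: "0 < c"
    \<comment> \<open>\<open>c'\<close> exceeds -\<eta> u(t) by half of the slack, rescaled to time
      t, so that the local majorant \<open>h\<close> of e -> w(t + e) has slope c/2 at 0.\<close>
    define c' where "c' = - \<eta> * u t + exp (- \<eta> * t) * c / 2"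
    define h where "h = (\<lambda>e. exp (\<eta> * (t + e)) * (u t + e * c'))"
    have "(h has_field_derivative exp (\<eta> * t) * (\<eta> * u t + c')) (at 0)"
      unfolding h_def by (auto intro!: derivative_eq_intros simp: algebra_simps)
    also have "exp (\<eta> * t) * (\<eta> * u t + c') = c / 2"
      by (simp add: c'_def mult.assoc[symmetric] exp_add[symmetric])
    finally have "((\<lambda>e. (h e - h 0) / e) \<longlongrightarrow> c / 2) (at_right 0)"
      unfolding DERIV_def by (auto intro: tendsto_mono at_le)
    then have "\<forall>\<^sub>F e in at_right 0. (h e - h 0) / e < c"
      using c by (intro order_tendstoD(2)[of _ "c / 2"]) auto
    moreover have "\<forall>\<^sub>F e in at_right 0. u (t + e) \<le> u t + e * c'"
      using c by (intro dini t) (simp add: c'_def)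
    ultimately show "\<forall>\<^sub>F e in at_right 0. w (t + e) \<le> w t + e * c"
      using eventually_at_right_less[of 0]
    proof eventually_elim
      case (elim e)
      have "w (t + e) \<le> h e" using elim(2) by (simp add: w_def h_def)
      also have "h e \<le> h 0 + e * c" using elim by (simp add: field_simps)
      finally show ?case by (simp add: h_def w_def)
    qed
  qed
  then have "exp (- \<eta> * T) * (exp (\<eta> * T) * u T) \<le> exp (- \<eta> * T) * u 0"
    by (intro mult_left_mono) (simp_all add: w_def)
  then show ?thesis by (simp add: mult.assoc[symmetric] exp_add[symmetric])
qed

section \<open>Growth of entrywise norms under multiplication from both sides\<close>

lemma induced_norm_nonneg:
  assumes "1 \<le> p" "0 < d" shows "0 \<le> induced_norm d (lp_norm d p) A"
proof -
  obtain v where "lp_norm d p v = 1" using ex_unit_lp_norm[OF assms] by blast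
  then show ?thesis using lp_norm_mat_vec_le[OF assms(1), of d A v] lp_norm_nonneg[of d p "mat_vec d A v"] by simp
qed

lemma grid_norm_mat_vec_rows_le:
  assumes "1 \<le> p" "0 < b"
  shows "grid_norm a b p (\<lambda>r. mat_vec b M (X r)) \<le> induced_norm b (lp_norm b p) M * grid_norm a b p X"
proof -
  have "grid_norm a b p (\<lambda>r. mat_vec b M (X r))
      \<le> lp_norm a p (\<lambda>r. induced_norm b (lp_norm b p) M * lp_norm b p (X r))"
    unfolding grid_norm_def using lp_norm_mat_vec_le[OF assms(1), of b M]
    by (intro lp_norm_mono assms) (auto simp: lp_norm_nonneg intro: order_trans[OF _ abs_ge_self])
  also have "\<dots> = induced_norm b (lp_norm b p) M * grid_norm a b p X"
    by (simp add: lp_norm_scale assms grid_norm_def induced_norm_nonneg)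
  finally show ?thesis .
qed

lemma grid_norm_mat_vec_cols_le:
  assumes "1 \<le> p" "0 < a"
  shows "grid_norm a b p (\<lambda>r c. mat_vec a M (\<lambda>r. X r c) r) \<le> induced_norm a (lp_norm a p) M * grid_norm a b p X"
  using grid_norm_mat_vec_rows_le[OF assms, of b M "\<lambda>c r. X r c"]
    grid_norm_transpose[OF assms(1), of a b "\<lambda>r c. mat_vec a M (\<lambda>r. X r c) r"]
    grid_norm_transpose[OF assms(1), of a b X] by simp

text \<open>
  The estimate rests on
  \<open>(I + \<epsilon>A) X (I + \<epsilon>B)\<^sup>T = X + \<epsilon>(A X + X B\<^sup>T) + O(\<epsilon>\<^sup>2)\<close>. It is here that both measures
  have to come from the same exponent \<open>p\<close>, so that the entrywise norm can be read both as a
  norm of rows and as a norm of columns.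
\<close>

lemma dini_grid_norm:
  fixes X :: "real \<Rightarrow> nmat"
  assumes p: "1 \<le> p" and ab: "0 < a" "0 < b" and t: "0 \<le> t"
    and deriv: "\<And>r c. r < a \<Longrightarrow> c < b \<Longrightarrow> ((\<lambda>s. X s r c) has_field_derivative
      (\<Sum>r'<a. A r r' * X t r' c) + (\<Sum>c'<b. B c c' * X t r c') + R r c) (at t within {0..})"
    and c0: "(matrix_measure a (lp_norm a p) A + matrix_measure b (lp_norm b p) B) * grid_norm a b p (X t)
      + grid_norm a b p R < c0"
  shows "\<forall>\<^sub>F e in at_right 0. grid_norm a b p (X (t + e)) \<le> grid_norm a b p (X t) + e * c0"
proof -
  let ?N = "grid_norm a b p" and ?x = "X t"
  let ?MA = "\<lambda>e i j. mat_id a i j + e * A i j" and ?MB = "\<lambda>e i j. mat_id b i j + e * B i j"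
  let ?IA = "\<lambda>e. induced_norm a (lp_norm a p) (?MA e)" and ?IB = "\<lambda>e. induced_norm b (lp_norm b p) (?MB e)"
  let ?gA = "\<lambda>e. (?IA e - 1) / e" and ?gB = "\<lambda>e. (?IB e - 1) / e"
  define D where "D r c = (\<Sum>r'<a. A r r' * ?x r' c) + (\<Sum>c'<b. B c c' * ?x r c')" for r c
  define Q where "Q r c = (\<Sum>r'<a. A r r' * (\<Sum>c'<b. B c c' * ?x r' c'))" for r c
  \<comment> \<open>\<open>Z e\<close> is exactly (I + e A) x (I + e B)^T; the second-order term
    \<open>Q\<close> is kept so that the norm is bounded by the product of the two induced
    norms.\<close>
  define Z where "Z e r c = ?x r c + e * D r c + e * (e * Q r c)" for e r c
  \<comment> \<open>The remainder compensates for that second-order term and is still o(e).\<close>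
  define E where "E e r c = X (t + e) r c - (Z e r c + e * R r c)" for e r c
  have idsum: "(\<Sum>j<d. (mat_id d i j + e * M i j) * v j) = v i + e * (\<Sum>j<d. M i j * v j)"
    if "i < d" for d i e and M :: nmat and v
  proof -
    have "(\<Sum>j<d. mat_id d i j * v j) = v i"
      using that by (simp add: mat_id_def if_distrib[of "\<lambda>x. x * _"] cong: if_cong)
    then show ?thesis by (simp add: distrib_right sum.distrib sum_distrib_left mult.assoc)
  qed
  have NZ: "?N (Z e) \<le> ?IA e * (?IB e * ?N ?x)" for e
  proof -
    have "?N (Z e) = ?N (\<lambda>r c. mat_vec a (?MA e) (\<lambda>r. mat_vec b (?MB e) (?x r) c) r)"
    proof (rule grid_norm_cong)
      fix r c assume rc: "r < a" "c < b"
      have "mat_vec a (?MA e) (\<lambda>r. mat_vec b (?MB e) (?x r) c) r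
          = (\<Sum>r'<a. ?MA e r r' * (?x r' c + e * (\<Sum>c'<b. B c c' * ?x r' c')))"
        using rc by (simp add: mat_vec_def idsum)
      also have "\<dots> = ?x r c + e * (\<Sum>c'<b. B c c' * ?x r c')
          + e * (\<Sum>r'<a. A r r' * (?x r' c + e * (\<Sum>c'<b. B c c' * ?x r' c')))"
        by (rule idsum[OF rc(1)])
      also have "\<dots> = Z e r c"
        by (simp add: Z_def D_def Q_def distrib_left sum.distrib sum_distrib_left mult_ac)
      finally show "Z e r c = mat_vec a (?MA e) (\<lambda>r. mat_vec b (?MB e) (?x r) c) r" ..
    qed
    also have "\<dots> \<le> ?IA e * ?N (\<lambda>r. mat_vec b (?MB e) (?x r))"
      using grid_norm_mat_vec_cols_le[OF p ab(1), of b "?MA e" "\<lambda>r. mat_vec b (?MB e) (?x r)"] .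
    also have "\<dots> \<le> ?IA e * (?IB e * ?N ?x)"
      by (intro mult_left_mono grid_norm_mat_vec_rows_le induced_norm_nonneg p ab)
    finally show ?thesis .
  qed
  have bound: "?N (X (t + e)) \<le> ?IA e * (?IB e * ?N ?x) + e * ?N R + (\<Sum>r<a. \<Sum>c<b. \<bar>E e r c\<bar>)"
    if "0 < e" for e
  proof -
    have "?N (X (t + e)) = ?N (\<lambda>r c. (Z e r c + e * R r c) + E e r c)"
      by (simp add: E_def)
    also have "\<dots> \<le> ?N (\<lambda>r c. Z e r c + e * R r c) + ?N (E e)" by (rule grid_norm_triangle[OF p])
    also have "\<dots> \<le> (?N (Z e) + e * ?N R) + (\<Sum>r<a. \<Sum>c<b. \<bar>E e r c\<bar>)"
      using grid_norm_triangle[OF p, of a b "Z e" "\<lambda>r c. e * R r c"] grid_norm_le_sum[OF p, of a b "E e"] that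
      by (simp add: grid_norm_scale[OF p])
    finally show ?thesis using NZ[of e] by simp
  qed
  \<comment> \<open>With the induced norms written as 1 + e \<open>?gA e\<close> and 1 + e
    \<open>?gB e\<close>, the bound becomes the norm at time t plus e h(e), and the limit of
    \<open>h\<close> is the left side of \<open>c0\<close>.\<close>
  define h where "h e = (?gA e + ?gB e + e * (?gA e * ?gB e)) * ?N ?x + ?N R
    + (\<Sum>r<a. \<Sum>c<b. \<bar>E e r c / e\<bar>)" for e
  have Elim: "((\<lambda>e. E e r c / e) \<longlongrightarrow> 0) (at_right 0)" if rc: "r < a" "c < b" for r c
  proof -
    have "((\<lambda>s. X s r c) has_field_derivative D r c + R r c) (at t within {t<..})"
      by (rule DERIV_subset[OF deriv[OF rc, folded D_def]]) (use t in auto)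
    then have "((\<lambda>y. (X y r c - ?x r c) / (y - t)) \<longlongrightarrow> D r c + R r c) (at_right t)"
      by (simp add: has_field_derivative_iff)
    then have "((\<lambda>e. (X (t + e) r c - ?x r c) / e) \<longlongrightarrow> D r c + R r c) (at_right 0)"
      by (subst (asm) filterlim_at_right_to_0) (simp add: add.commute)
    then have "((\<lambda>e. (X (t + e) r c - ?x r c) / e - (D r c + R r c) - e * Q r c) \<longlongrightarrow>
        (D r c + R r c) - (D r c + R r c) - 0 * Q r c) (at_right 0)"
      by (intro tendsto_intros)
    moreover have "\<forall>\<^sub>F e in at_right 0. (X (t + e) r c - ?x r c) / e - (D r c + R r c) - e * Q r c = E e r c / e"
      using eventually_at_right_less[of 0]
      by eventually_elim (simp add: E_def Z_def field_simps)
    ultimately show ?thesis by (simp add: filterlim_cong[OF refl refl])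
  qed
  have "(h \<longlongrightarrow> (matrix_measure a (lp_norm a p) A + matrix_measure b (lp_norm b p) B
      + 0 * (matrix_measure a (lp_norm a p) A * matrix_measure b (lp_norm b p) B)) * ?N ?x + ?N R
      + (\<Sum>r<a. \<Sum>c<b. \<bar>0\<bar>)) (at_right 0)"
    unfolding h_def
    by (intro tendsto_intros matrix_measure_tendsto p ab Elim) auto
  then have "\<forall>\<^sub>F e in at_right 0. h e < c0"
    using c0 by (intro order_tendstoD(2)) simp_all
  then show ?thesis using eventually_at_right_less[of 0]
  proof eventually_elim
    case (elim e)
    have "?IA e = 1 + e * ?gA e" "?IB e = 1 + e * ?gB e" using elim by simp_all
    then have "?IA e * (?IB e * ?N ?x) = (1 + e * ?gA e) * ((1 + e * ?gB e) * ?N ?x)" by simp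
    also have "\<dots> = ?N ?x + e * ((?gA e + ?gB e + e * (?gA e * ?gB e)) * ?N ?x)"
      by (simp only: distrib_left distrib_right mult_ac mult_1_left mult_1_right add_ac)
    finally have 1: "?IA e * (?IB e * ?N ?x) = \<dots>" .
    have 2: "(\<Sum>r<a. \<Sum>c<b. \<bar>E e r c\<bar>) = e * (\<Sum>r<a. \<Sum>c<b. \<bar>E e r c / e\<bar>)"
      using elim by (simp add: sum_distrib_left abs_mult)
    have "?N (X (t + e)) \<le> ?N ?x + e * h e"
      using bound[OF elim(2)] unfolding 1 2 h_def by (simp add: distrib_left)
    also have "\<dots> \<le> ?N ?x + e * c0" using elim by simp
    finally show ?case .
  qed
qed


section \<open>Block triangular systems\<close>

lemma continuous_on_grid_norm:
  fixes X :: "real \<Rightarrow> nmat"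
  assumes p: "1 \<le> p" and cont: "\<And>r c. r < a \<Longrightarrow> c < b \<Longrightarrow> continuous_on S (\<lambda>t. X t r c)"
  shows "continuous_on S (\<lambda>t. grid_norm a b p (X t))"
  unfolding continuous_on_def
proof
  fix t assume t: "t \<in> S"
  have le: "grid_norm a b p Y - grid_norm a b p Z \<le> (\<Sum>r<a. \<Sum>c<b. \<bar>Y r c - Z r c\<bar>)" for Y Z
    using grid_norm_triangle[OF p, of a b Z "\<lambda>r c. Y r c - Z r c"]
      grid_norm_le_sum[OF p, of a b "\<lambda>r c. Y r c - Z r c"] by simp
  have "((\<lambda>s. \<Sum>r<a. \<Sum>c<b. \<bar>X s r c - X t r c\<bar>) \<longlongrightarrow> (\<Sum>r<a. \<Sum>c<b. \<bar>X t r c - X t r c\<bar>)) (at t within S)"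
    using cont t by (intro tendsto_intros) (auto simp: continuous_on_def)
  then have lim: "((\<lambda>s. \<Sum>r<a. \<Sum>c<b. \<bar>X s r c - X t r c\<bar>) \<longlongrightarrow> 0) (at t within S)" by simp
  have "norm (grid_norm a b p (X s) - grid_norm a b p (X t)) \<le> (\<Sum>r<a. \<Sum>c<b. \<bar>X s r c - X t r c\<bar>)" for s
    using le[of "X s" "X t"] le[of "X t" "X s"] unfolding abs_minus_commute[of "X t _ _"] by (simp add: abs_le_iff)
  then have "((\<lambda>s. grid_norm a b p (X s) - grid_norm a b p (X t)) \<longlongrightarrow> 0) (at t within S)"
    by (intro Lim_null_comparison[OF always_eventually lim]) simp
  then show "((\<lambda>s. grid_norm a b p (X s)) \<longlongrightarrow> grid_norm a b p (X t)) (at t within S)"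
    by (simp add: LIM_zero_iff)
qed

lemma sorted_filter_append:
  fixes xs :: "nat list"
  assumes "sorted xs" shows "filter (\<lambda>x. x < n) xs @ filter (\<lambda>x. n \<le> x) xs = xs"
  using assms
proof (induction xs)
  case (Cons a xs)
  show ?case
  proof (cases "a < n")
    case False
    then have "filter (\<lambda>x. x < n) (a # xs) = []" "filter (\<lambda>x. n \<le> x) (a # xs) = a # xs"
      using Cons.prems by (auto simp: filter_empty_conv filter_id_conv)
    then show ?thesis by simp
  qed (use Cons in simp)
qed simp

lemma sum_add_split:
  fixes f :: "nat \<Rightarrow> real"
  shows "(\<Sum>l<n + m. f l) = (\<Sum>l<n. f l) + (\<Sum>l<m. f (n + l))"
  by (induction m) simp_all

lemma is_norm_on_ex_unit:
  assumes "is_norm_on d \<nu>" "0 < d" shows "\<exists>v\<in>vspace d. \<nu> v = 1"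
proof -
  define u :: "nat \<Rightarrow> real" where "u = (\<lambda>i. if i = 0 then 1 else 0)"
  have u: "u \<in> vspace d" "u \<noteq> (\<lambda>_. 0)" using assms(2) by (auto simp: u_def vspace_def fun_eq_iff)
  then have "\<nu> u > 0" using assms(1) unfolding is_norm_on_def by (metis less_le)
  then have "\<nu> (\<lambda>i. inverse (\<nu> u) * u i) = 1" using assms(1) u(1) unfolding is_norm_on_def by auto
  moreover have "(\<lambda>i. inverse (\<nu> u) * u i) \<in> vspace d" using u(1) by (simp add: vspace_def)
  ultimately show ?thesis by blast
qed

text \<open>Truncated subtraction makes \<open>k - n\<close> the integer max 0 (k - n). For i <= k,
  the binomials n choose (k - i) and m choose i are both positive exactly on this range, so every
  block has entries.\<close>

locale compound_blocks =
  fixes n m k :: nat and p :: "nat \<Rightarrow> ereal"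
  assumes k_le: "k \<le> n + m" and p: "\<And>i. i \<in> {k - n..min m k} \<Longrightarrow> 1 \<le> p i"
begin

abbreviation blocks :: "nat set" where "blocks \<equiv> {k - n..min m k}"

text \<open>
  Indices of the second subsystem are shifted by \<open>n\<close>; \<open>block i Y\<close> collects the values of \<open>Y\<close> at
  the increasing tuples with exactly \<open>i\<close> shifted entries.
\<close>

definition block :: "nat \<Rightarrow> (nat list \<Rightarrow> real) \<Rightarrow> nmat" where
  "block i Y r c = Y (ktuples n (k - i) ! r @ map ((+) n) (ktuples m i ! c))"

definition block_norm :: "nat \<Rightarrow> (nat list \<Rightarrow> real) \<Rightarrow> real" where
  "block_norm i Y = grid_norm (n choose (k - i)) (m choose i) (p i) (block i Y)"

lemma block_norm_nonneg: "0 \<le> block_norm i Y"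
  by (simp add: block_norm_def grid_norm_nonneg)

lemma block_list_props:
  assumes "i \<le> k" "us \<in> inc_lists n (k - i)" "ws \<in> inc_lists m i"
  shows "length (us @ map ((+) n) ws) = k" "set (us @ map ((+) n) ws) \<subseteq> {..<n + m}"
  using assms by (auto simp: inc_lists_def subset_iff)

text \<open>
  Outside of \<open>blocks\<close> the pigeonhole principle forces a repeated entry.
\<close>

lemma abs_alternating_le_block_norm:
  assumes Y: "alternating k Y" and xs: "length xs = k" "set xs \<subseteq> {..<n + m}"
    and i: "i = length (filter (\<lambda>x. n \<le> x) xs)"
  shows "Y xs = 0 \<or> i \<in> blocks \<and> \<bar>Y xs\<bar> \<le> block_norm i Y"
proof (cases "distinct xs")
  case False
  then show ?thesis using alternating_eq_0[OF Y xs(1)] by simp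
next
  case True
  \<comment> \<open>In the sorted tuple the unshifted entries precede the shifted ones, so it
    indexes an entry of block \<open>i\<close>.\<close>
  define us ws where "us = filter (\<lambda>x. x < n) (sort xs)" and "ws = map (\<lambda>x. x - n) (filter (\<lambda>x. n \<le> x) (sort xs))"
  have "map ((+) n) ws = filter (\<lambda>x. n \<le> x) (sort xs)"
    unfolding ws_def map_map by (rule map_idI) auto
  then have split: "us @ map ((+) n) ws = sort xs"
    using sorted_filter_append[of "sort xs" n] by (simp add: us_def)
  have sorted: "sorted_wrt (<) (us @ map ((+) n) ws)" unfolding split using True by (simp add: strict_sorted_iff)
  have "length ws = i" unfolding ws_def i by (metis filter_sort length_map length_sort)
  moreover have "length us + length ws = k"
    using arg_cong[OF split, of length] xs(1) by simp
  moreover have "set us \<union> (+) n ` set ws \<subseteq> {..<n + m}"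
    using arg_cong[OF split, of set] xs(2) by simp
  ultimately have us: "us \<in> inc_lists n (k - i)" and ws: "ws \<in> inc_lists m i"
    using sorted by (auto simp: inc_lists_def sorted_wrt_append sorted_wrt_map us_def image_subset_iff)
  have "card (set us) = k - i" "card (set us) \<le> n" "card (set ws) = i" "card (set ws) \<le> m" "i \<le> k"
    using us ws \<open>length us + length ws = k\<close> \<open>length ws = i\<close> card_mono[of "{..<n}" "set us"] card_mono[of "{..<m}" "set ws"]
    by (auto simp: inc_lists_def strict_sorted_iff distinct_card)
  then have i_in: "i \<in> blocks" by auto
  obtain r c where rc: "r < n choose (k - i)" "ktuples n (k - i) ! r = us" "c < m choose i" "ktuples m i ! c = ws"
    using ktuples_ex_nth us ws by metis
  obtain q where "q permutes {..<k}" "permute_list q (sort xs) = xs" "Y xs = of_int (sign q) * Y (sort xs)"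
    by (rule alternating_sort[OF Y xs(1)])
  then have "\<bar>Y xs\<bar> = \<bar>block i Y r c\<bar>"
    by (simp add: block_def rc split abs_mult sign_def)
  also have "\<dots> \<le> block_norm i Y"
    unfolding block_norm_def using p[OF i_in] rc by (intro abs_le_grid_norm)
  finally show ?thesis using i_in by simp
qed

text \<open>The contribution of J21: a shifted entry gives way to an unshifted one, which leaves i -
  1 shifted entries in an order that need not be increasing.\<close>

definition lower_coupling :: "nmat \<Rightarrow> nat \<Rightarrow> (nat list \<Rightarrow> real) \<Rightarrow> nmat" where
  "lower_coupling J i Y r c = (\<Sum>b<i. \<Sum>l<n. J (n + ktuples m i ! c ! b) l *
     Y (ktuples n (k - i) ! r @ (map ((+) n) (ktuples m i ! c))[b := l]))"

text \<open>With one group of entries fixed, Y alternates in the other, so each group contributes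
  its own additive compound. J12 = 0 keeps an unshifted entry from becoming shifted; the opposite
  replacement gives the coupling.\<close>

lemma block_generator:
  assumes Y: "alternating k Y" and i: "i \<le> k" and rc: "r < n choose (k - i)" "c < m choose i"
    and J11: "\<And>a b. a < n \<Longrightarrow> b < n \<Longrightarrow> J a b = A a b"
    and J12: "\<And>a b. a < n \<Longrightarrow> b < m \<Longrightarrow> J a (n + b) = 0"
    and J22: "\<And>a b. a < m \<Longrightarrow> b < m \<Longrightarrow> J (n + a) (n + b) = B a b"
  defines "x \<equiv> ktuples n (k - i) ! r @ map ((+) n) (ktuples m i ! c)"
  shows "(\<Sum>a<k. \<Sum>l<n + m. J (x ! a) l * Y (x[a := l])) =
    (\<Sum>r'<n choose (k - i). add_compound n (k - i) A r r' * block i Y r' c)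
    + (\<Sum>c'<m choose i. add_compound m i B c c' * block i Y r c') + lower_coupling J i Y r c"
proof -
  define us ws where "us = ktuples n (k - i) ! r" and "ws = ktuples m i ! c"
  have us: "length us = k - i" "\<And>a. a < k - i \<Longrightarrow> us ! a < n"
    and ws: "length ws = i" "\<And>b. b < i \<Longrightarrow> ws ! b < m"
    using ktuples_nth[OF rc(1)] ktuples_nth[OF rc(2)] by (auto simp: us_def ws_def inc_lists_def subset_iff)
  have len: "length us + i = k" using us(1) i by simp
  let ?ws = "map ((+) n) ws"
  have x: "x = us @ ?ws" by (simp add: x_def us_def ws_def)
  have altU: "alternating (k - i) (\<lambda>zs. Y (zs @ ?ws))"
    unfolding alternating_def
  proof (intro allI impI)
    fix zs :: "nat list" and a b assume "length zs = k - i" "a < k - i" "b < k - i" "a \<noteq> b"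
    then show "Y (zs[a := zs ! b, b := zs ! a] @ ?ws) = - Y (zs @ ?ws)"
      using Y[unfolded alternating_def, rule_format, of "zs @ ?ws" a b] ws(1) i
      by (simp add: nth_append list_update_append)
  qed
  have altW: "alternating i (\<lambda>zs. Y (us @ map ((+) n) zs))"
    unfolding alternating_def
  proof (intro allI impI)
    fix zs :: "nat list" and a b assume "length zs = i" "a < i" "b < i" "a \<noteq> b"
    then show "Y (us @ map ((+) n) (zs[a := zs ! b, b := zs ! a])) = - Y (us @ map ((+) n) zs)"
      using Y[unfolded alternating_def, rule_format, of "us @ map ((+) n) zs" "length us + a" "length us + b"] len
      by (simp add: nth_append list_update_append map_update)
  qed
  have upper: "(\<Sum>l<n + m. J (x ! a) l * Y (x[a := l])) = (\<Sum>l<n. A (us ! a) l * Y (us[a := l] @ ?ws))"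
    if "a < k - i" for a
    using that len us(2) J11 J12 by (simp add: sum_add_split x nth_append list_update_append)
  have lower: "(\<Sum>l<n + m. J (x ! (k - i + b)) l * Y (x[k - i + b := l])) =
      (\<Sum>l<m. B (ws ! b) l * Y (us @ map ((+) n) (ws[b := l])))
      + (\<Sum>l<n. J (n + ws ! b) l * Y (us @ ?ws[b := l]))"
    if "b < i" for b
    unfolding us(1)[symmetric]
    using that len ws J22 by (simp add: sum_add_split x nth_append list_update_append map_update)
  have "(\<Sum>a<k. \<Sum>l<n + m. J (x ! a) l * Y (x[a := l])) =
      (\<Sum>a<k - i. \<Sum>l<n + m. J (x ! a) l * Y (x[a := l]))
      + (\<Sum>b<i. \<Sum>l<n + m. J (x ! (k - i + b)) l * Y (x[k - i + b := l]))"
    using sum_add_split[of "\<lambda>a. \<Sum>l<n + m. J (x ! a) l * Y (x[a := l])" "k - i" i] i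
    by (simp only: le_add_diff_inverse2)
  also have "(\<Sum>a<k - i. \<Sum>l<n + m. J (x ! a) l * Y (x[a := l])) =
      (\<Sum>a<k - i. \<Sum>l<n. A (us ! a) l * Y (us[a := l] @ ?ws))"
    by (intro sum.cong refl upper) simp
  also have "(\<Sum>b<i. \<Sum>l<n + m. J (x ! (k - i + b)) l * Y (x[k - i + b := l])) =
      (\<Sum>b<i. \<Sum>l<m. B (ws ! b) l * Y (us @ map ((+) n) (ws[b := l])))
      + (\<Sum>b<i. \<Sum>l<n. J (n + ws ! b) l * Y (us @ ?ws[b := l]))"
    unfolding sum.distrib[symmetric] by (intro sum.cong refl lower[unfolded sum.distrib[symmetric]]) simp
  also have "(\<Sum>a<k - i. \<Sum>l<n. A (us ! a) l * Y (us[a := l] @ ?ws)) =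
      (\<Sum>r'<n choose (k - i). add_compound n (k - i) A r r' * block i Y r' c)"
    using add_compound_apply[OF altU rc(1), of A] by (simp add: us_def ws_def block_def)
  also have "(\<Sum>b<i. \<Sum>l<m. B (ws ! b) l * Y (us @ map ((+) n) (ws[b := l]))) =
      (\<Sum>c'<m choose i. add_compound m i B c c' * block i Y r c')"
    using add_compound_apply[OF altW rc(2), of B] by (simp add: us_def ws_def block_def)
  also have "(\<Sum>b<i. \<Sum>l<n. J (n + ws ! b) l * Y (us @ ?ws[b := l])) = lower_coupling J i Y r c"
    by (simp add: lower_coupling_def us_def ws_def)
  finally show ?thesis by (simp only: add.assoc)
qed

text \<open>The value 0 stands for a missing predecessor: at the lower end of the range, no tuple
  with one shifted entry fewer carries a nonzero value. The test on \<open>i\<close> is explicit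
  because \<open>0 - 1 = 0\<close>.\<close>

definition prev_norm :: "nat \<Rightarrow> (nat list \<Rightarrow> real) \<Rightarrow> real" where
  "prev_norm i Y = (if 0 < i \<and> i - 1 \<in> blocks then block_norm (i - 1) Y else 0)"

lemma prev_norm_nonneg: "0 \<le> prev_norm i Y"
  by (simp add: prev_norm_def block_norm_nonneg)

lemma abs_lower_coupling_le:
  assumes Y: "alternating k Y" and i: "i \<le> k" and rc: "r < n choose (k - i)" "c < m choose i"
    and J21: "\<And>a b. a < m \<Longrightarrow> b < n \<Longrightarrow> \<bar>J (n + a) b\<bar> \<le> C"
  shows "\<bar>lower_coupling J i Y r c\<bar> \<le> real i * real n * C * prev_norm i Y"
proof -
  define us ws where "us = ktuples n (k - i) ! r" and "ws = ktuples m i ! c"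
  have us: "length us = k - i" "set us \<subseteq> {..<n}" and ws: "length ws = i" "set ws \<subseteq> {..<m}"
    and wsb: "\<And>b. b < i \<Longrightarrow> ws ! b < m"
    using ktuples_nth[OF rc(1)] ktuples_nth[OF rc(2)] by (auto simp: us_def ws_def inc_lists_def subset_iff)
  let ?ws = "map ((+) n) ws"
  have entry_le: "\<bar>J (n + ws ! b) l * Y (us @ ?ws[b := l])\<bar> \<le> C * prev_norm i Y" if bl: "b < i" "l < n" for b l
  proof -
    let ?z = "us @ ?ws[b := l]"
    \<comment> \<open>In this form the number of shifted entries is seen to drop by one:
      \<open>us\<close> and the new entry lie below \<open>n\<close>.\<close>
    have eq: "?ws[b := l] = take b ?ws @ l # drop (Suc b) ?ws"
      using bl ws by (intro upd_conv_take_nth_drop) simp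
    have "filter (\<lambda>x. n \<le> x) us = []" using us(2) by (auto simp: filter_empty_conv)
    moreover have "filter (\<lambda>x. n \<le> x) (take b ?ws) = take b ?ws" "filter (\<lambda>x. n \<le> x) (drop (Suc b) ?ws) = drop (Suc b) ?ws"
      by (auto simp: filter_id_conv dest!: in_set_takeD in_set_dropD)
    ultimately have "i - 1 = length (filter (\<lambda>x. n \<le> x) ?z)"
      unfolding eq using bl ws by simp
    moreover have "length ?z = k" using us ws i by simp
    moreover have "set ?z \<subseteq> {..<n + m}"
      using us(2) ws(2) bl(2) set_update_subset_insert[of ?ws b l] by fastforce
    ultimately have "Y ?z = 0 \<or> i - 1 \<in> blocks \<and> \<bar>Y ?z\<bar> \<le> block_norm (i - 1) Y"
      by (intro abs_alternating_le_block_norm[OF Y])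
    then have "\<bar>Y ?z\<bar> \<le> prev_norm i Y" using bl(1) prev_norm_nonneg[of i Y] by (auto simp: prev_norm_def)
    moreover have "\<bar>J (n + ws ! b) l\<bar> \<le> C" using J21 wsb bl by blast
    ultimately show ?thesis unfolding abs_mult by (intro mult_mono) auto
  qed
  have "\<bar>lower_coupling J i Y r c\<bar> \<le> (\<Sum>b<i. \<Sum>l<n. \<bar>J (n + ws ! b) l * Y (us @ ?ws[b := l])\<bar>)"
    unfolding lower_coupling_def us_def ws_def by (rule order_trans[OF sum_abs sum_mono[OF sum_abs]])
  also have "\<dots> \<le> (\<Sum>b<i. \<Sum>l<n. C * prev_norm i Y)" by (intro sum_mono entry_le) auto
  finally show ?thesis by simp
qed

text \<open>The summand \<open>1\<close> only serves to make the constant positive, since it is used as a divisor.\<close>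

definition coupling_const :: "real \<Rightarrow> real" where
  "coupling_const C = 1 + (\<Sum>i\<le>k. real (n choose (k - i)) * real (m choose i) * (real i * real n * C))"

lemma coupling_const_pos: "0 \<le> C \<Longrightarrow> 0 < coupling_const C"
  unfolding coupling_const_def by (intro add_pos_nonneg sum_nonneg) auto

lemma grid_norm_lower_coupling_le:
  assumes Y: "alternating k Y" and i: "i \<in> blocks" and C: "0 \<le> C"
    and J21: "\<And>a b. a < m \<Longrightarrow> b < n \<Longrightarrow> \<bar>J (n + a) b\<bar> \<le> C"
  shows "grid_norm (n choose (k - i)) (m choose i) (p i) (lower_coupling J i Y)
    \<le> coupling_const C * prev_norm i Y"
proof -
  let ?a = "n choose (k - i)" and ?b = "m choose i"
  have "grid_norm ?a ?b (p i) (lower_coupling J i Y) \<le> (\<Sum>r<?a. \<Sum>c<?b. \<bar>lower_coupling J i Y r c\<bar>)"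
    by (rule grid_norm_le_sum[OF p[OF i]])
  also have "\<dots> \<le> (\<Sum>r<?a. \<Sum>c<?b. real i * real n * C * prev_norm i Y)"
    using i by (intro sum_mono abs_lower_coupling_le[OF Y] J21) auto
  also have "\<dots> = real ?a * real ?b * (real i * real n * C) * prev_norm i Y" by simp
  also have "\<dots> \<le> coupling_const C * prev_norm i Y"
  proof (intro mult_right_mono prev_norm_nonneg)
    have "real ?a * real ?b * (real i * real n * C)
        \<le> (\<Sum>i\<le>k. real (n choose (k - i)) * real (m choose i) * (real i * real n * C))"
      using i C by (intro member_le_sum[of i "{..k}" "\<lambda>i. real (n choose (k - i)) * real (m choose i) * (real i * real n * C)"]) auto
    then show "real ?a * real ?b * (real i * real n * C) \<le> coupling_const C" by (simp add: coupling_const_def)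
  qed
  finally show ?thesis .
qed

section \<open>The weighted norm and its exponential decay\<close>

definition weighted_norm :: "real \<Rightarrow> (nat list \<Rightarrow> real) \<Rightarrow> real" where
  "weighted_norm \<delta> Y = (\<Sum>i\<in>blocks. \<delta> ^ i * block_norm i Y)"

text \<open>Shifting the index pairs \<delta>^i with block i - 1 and so releases one factor
  \<delta>; this is why the weights are powers.\<close>

lemma sum_prev_norm_le:
  assumes "0 \<le> \<delta>" shows "(\<Sum>i\<in>blocks. \<delta> ^ i * prev_norm i Y) \<le> \<delta> * weighted_norm \<delta> Y"
proof -
  let ?S = "{i \<in> blocks. 0 < i \<and> i - 1 \<in> blocks}"
  have "(\<Sum>i\<in>blocks. \<delta> ^ i * prev_norm i Y) = (\<Sum>i\<in>?S. \<delta> * (\<delta> ^ (i - 1) * block_norm (i - 1) Y))"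
  proof (rule sum.mono_neutral_cong_right)
    fix i assume "i \<in> ?S"
    then have "0 < i" "prev_norm i Y = block_norm (i - 1) Y" by (auto simp: prev_norm_def)
    moreover have "\<delta> ^ i = \<delta> * \<delta> ^ (i - 1)" using \<open>0 < i\<close> by (simp add: power_eq_if)
    ultimately show "\<delta> ^ i * prev_norm i Y = \<delta> * (\<delta> ^ (i - 1) * block_norm (i - 1) Y)" by simp
  next
    have "prev_norm i Y = 0" if "i \<in> blocks - ?S" for i
    proof -
      from that have "\<not> (0 < i \<and> i - 1 \<in> blocks)" by blast
      then show ?thesis unfolding prev_norm_def by (rule if_not_P)
    qed
    then show "\<forall>i\<in>blocks - ?S. \<delta> ^ i * prev_norm i Y = 0" by simp
  qed auto
  also have "\<dots> = (\<Sum>j\<in>(\<lambda>i. i - 1) ` ?S. \<delta> * (\<delta> ^ j * block_norm j Y))"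
  proof (subst sum.reindex)
    show "inj_on (\<lambda>i. i - 1) ?S" by (auto simp: inj_on_def)
  qed simp
  also have "\<dots> \<le> (\<Sum>j\<in>blocks. \<delta> * (\<delta> ^ j * block_norm j Y))"
    using assms by (intro sum_mono2) (auto simp: block_norm_nonneg)
  finally show ?thesis by (simp add: weighted_norm_def sum_distrib_left)
qed

lemma block_norm_tensor_add:
  "i \<in> blocks \<Longrightarrow> block_norm i (tensor d k (\<lambda>j. v j + w j) M) \<le>
    block_norm i (tensor d k v M) + block_norm i (tensor d k w M)"
  unfolding block_norm_def block_def[abs_def] tensor_add by (rule grid_norm_triangle[OF p])

lemma block_norm_tensor_scale:
  "i \<in> blocks \<Longrightarrow> block_norm i (tensor d k (\<lambda>j. s * v j) M) = \<bar>s\<bar> * block_norm i (tensor d k v M)"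
  unfolding block_norm_def block_def[abs_def] tensor_scale by (rule grid_norm_scale[OF p])

text \<open>Definiteness is the point to check: each coordinate of v is a value at an increasing
  tuple, and the number of its shifted entries tells which block controls it.\<close>

lemma is_norm_on_weighted_norm:
  assumes "0 < \<delta>"
  shows "is_norm_on ((n + m) choose k) (\<lambda>v. weighted_norm \<delta> (tensor (n + m) k v (mat_id (n + m))))"
  unfolding is_norm_on_def
proof (intro conjI ballI allI)
  let ?T = "\<lambda>v. tensor (n + m) k v (mat_id (n + m))"
  fix v w :: "nat \<Rightarrow> real" and s :: real assume v: "v \<in> vspace ((n + m) choose k)"
  have nonneg: "0 \<le> weighted_norm \<delta> Y" for Y
    unfolding weighted_norm_def using assms by (intro sum_nonneg) (simp add: block_norm_nonneg)
  show "0 \<le> weighted_norm \<delta> (?T v)" by (rule nonneg)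
  show "weighted_norm \<delta> (?T (\<lambda>i. s * v i)) = \<bar>s\<bar> * weighted_norm \<delta> (?T v)"
    by (simp add: weighted_norm_def block_norm_tensor_scale sum_distrib_left mult_ac)
  show "weighted_norm \<delta> (?T (\<lambda>i. v i + w i)) \<le> weighted_norm \<delta> (?T v) + weighted_norm \<delta> (?T w)"
    unfolding weighted_norm_def sum.distrib[symmetric] distrib_left[symmetric]
    using assms by (intro sum_mono mult_left_mono block_norm_tensor_add) auto
  show "weighted_norm \<delta> (?T v) = 0 \<longleftrightarrow> v = (\<lambda>_. 0)"
  proof
    assume "v = (\<lambda>_. 0)"
    then have "?T v = ?T (\<lambda>i. 0 * v i)" by simp
    moreover have "\<delta> ^ i * block_norm i (?T (\<lambda>i. 0 * v i)) = 0" if "i \<in> blocks" for i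
      using block_norm_tensor_scale[OF that, of "n + m" 0 v "mat_id (n + m)"] by simp
    then have "weighted_norm \<delta> (?T (\<lambda>i. 0 * v i)) = 0"
      unfolding weighted_norm_def by (intro sum.neutral ballI)
    ultimately show "weighted_norm \<delta> (?T v) = 0" by simp
  next
    assume "weighted_norm \<delta> (?T v) = 0"
    then have zero: "block_norm i (?T v) = 0" if "i \<in> blocks" for i
      unfolding weighted_norm_def using that assms
      by (subst (asm) sum_nonneg_eq_0_iff) (auto simp: block_norm_nonneg)
    show "v = (\<lambda>_. 0)"
    proof
      fix j
      show "v j = 0"
      proof (cases "j < (n + m) choose k")
        case True
        let ?x = "ktuples (n + m) k ! j"
        let ?i = "length (filter (\<lambda>a. n \<le> a) ?x)"
        have x: "length ?x = k" "set ?x \<subseteq> {..<n + m}"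
          using ktuples_nth[OF True] by (auto simp: inc_lists_def)
        have "?T v ?x = 0 \<or> ?i \<in> blocks \<and> \<bar>?T v ?x\<bar> \<le> block_norm ?i (?T v)"
          by (rule abs_alternating_le_block_norm[OF alternating_tensor x refl])
        then have "?T v ?x = 0"
        proof (elim disjE conjE)
          assume "?i \<in> blocks" "\<bar>?T v ?x\<bar> \<le> block_norm ?i (?T v)"
          then show "?T v ?x = 0" unfolding zero[OF \<open>?i \<in> blocks\<close>] by linarith
        qed
        then show ?thesis by (simp add: tensor_mat_id_ktuples[OF True])
      next
        case False
        then show ?thesis using v by (simp add: vspace_def)
      qed
    qed
  qed
qed

text \<open>\<delta> times the coupling constant is \<eta>/2, so half of the common rate survives
  the coupling. Neither \<delta> nor the norm refers to \<Phi>, so one norm serves all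
  trajectories.\<close>

lemma mult_compound_decay:
  fixes \<Phi> :: "real \<Rightarrow> nmat"
  assumes \<eta>: "0 < \<eta>" and C: "0 \<le> C"
    and J11: "\<And>t a b. 0 \<le> t \<Longrightarrow> a < n \<Longrightarrow> b < n \<Longrightarrow> J t a b = A t a b"
    and J12: "\<And>t a b. 0 \<le> t \<Longrightarrow> a < n \<Longrightarrow> b < m \<Longrightarrow> J t a (n + b) = 0"
    and J22: "\<And>t a b. 0 \<le> t \<Longrightarrow> a < m \<Longrightarrow> b < m \<Longrightarrow> J t (n + a) (n + b) = B t a b"
    and J21: "\<And>t a b. 0 \<le> t \<Longrightarrow> a < m \<Longrightarrow> b < n \<Longrightarrow> \<bar>J t (n + a) b\<bar> \<le> C"
    and meas: "\<And>t i. 0 \<le> t \<Longrightarrow> i \<in> blocks \<Longrightarrow>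
      matrix_measure (n choose (k - i)) (lp_norm (n choose (k - i)) (p i)) (add_compound n (k - i) (A t))
      + matrix_measure (m choose i) (lp_norm (m choose i) (p i)) (add_compound m i (B t)) \<le> - \<eta>"
    and init: "\<And>i j. i < n + m \<Longrightarrow> j < n + m \<Longrightarrow> \<Phi> 0 i j = mat_id (n + m) i j"
    and ode: "\<And>t i j. 0 \<le> t \<Longrightarrow> i < n + m \<Longrightarrow> j < n + m \<Longrightarrow>
      ((\<lambda>s. \<Phi> s i j) has_field_derivative (\<Sum>l<n + m. J t i l * \<Phi> t l j)) (at t within {0..})"
    and T: "0 \<le> T"
  defines "\<delta> \<equiv> \<eta> / (2 * coupling_const C)"
  shows "induced_norm ((n + m) choose k) (\<lambda>v. weighted_norm \<delta> (tensor (n + m) k v (mat_id (n + m))))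
    (mult_compound (n + m) (n + m) k (\<Phi> T)) \<le> exp (- (\<eta> / 2) * T)"
proof (rule induced_norm_le)
  let ?K = "coupling_const C" and ?d = "n + m"
  have K: "0 < ?K" using C by (rule coupling_const_pos)
  have \<delta>: "0 < \<delta>" "\<delta> * ?K = \<eta> / 2" using \<eta> K by (auto simp: \<delta>_def)
  show "\<exists>v\<in>vspace (?d choose k). weighted_norm \<delta> (tensor ?d k v (mat_id ?d)) = 1"
    using is_norm_on_ex_unit[OF is_norm_on_weighted_norm[OF \<delta>(1)]] k_le by simp
  fix v assume v: "v \<in> vspace (?d choose k)" "weighted_norm \<delta> (tensor ?d k v (mat_id ?d)) = 1"
  define Y where "Y t = tensor ?d k v (\<Phi> t)" for t
  have Y: "alternating k (Y t)" for t unfolding Y_def by (rule alternating_tensor)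
  have block_deriv: "((\<lambda>s. block i (Y s) r c) has_field_derivative
      (\<Sum>r'<n choose (k - i). add_compound n (k - i) (A t) r r' * block i (Y t) r' c)
      + (\<Sum>c'<m choose i. add_compound m i (B t) c c' * block i (Y t) r c')
      + lower_coupling (J t) i (Y t) r c) (at t within {0..})"
    if "0 \<le> t" "i \<in> blocks" "r < n choose (k - i)" "c < m choose i" for t i r c
  proof -
    have i: "i \<le> k" using that by simp
    note x = block_list_props[OF i ktuples_nth[OF that(3)] ktuples_nth[OF that(4)]]
    have eq: "(\<Sum>a<k. \<Sum>l<?d. J t ((ktuples n (k - i) ! r @ map ((+) n) (ktuples m i ! c)) ! a) l *
          Y t ((ktuples n (k - i) ! r @ map ((+) n) (ktuples m i ! c))[a := l])) =
        (\<Sum>r'<n choose (k - i). add_compound n (k - i) (A t) r r' * block i (Y t) r' c)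
        + (\<Sum>c'<m choose i. add_compound m i (B t) c c' * block i (Y t) r c')
        + lower_coupling (J t) i (Y t) r c"
      using that(1) by (intro block_generator[OF Y i that(3,4)] J11 J12 J22)
    show ?thesis
      unfolding eq[symmetric]
      using has_field_derivative_tensor[OF ode[OF that(1)] x, where v=v] by (simp add: block_def Y_def)
  qed
  have cont: "continuous_on {0..} (\<lambda>t. weighted_norm \<delta> (Y t))"
    unfolding weighted_norm_def block_norm_def
  proof (intro continuous_intros continuous_on_grid_norm p)
    fix i r c assume "i \<in> blocks" "r < n choose (k - i)" "c < m choose i"
    then show "continuous_on {0..} (\<lambda>t. block i (Y t) r c)"
      using block_deriv by (intro DERIV_continuous_on) auto
  qed
  have "weighted_norm \<delta> (Y T) \<le> exp (- (\<eta> / 2) * T) * weighted_norm \<delta> (Y 0)"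
  proof (rule dini_exponential_decay[OF cont _ T])
    fix t c assume t: "0 \<le> t" and c: "- (\<eta> / 2) * weighted_norm \<delta> (Y t) < c"
    \<comment> \<open>\<open>L i\<close> bounds the right-hand growth rate of block i; with weights
      \<delta>^i these bounds sum to at most -\<eta>/2 times the weighted norm.\<close>
    define L where "L i = - \<eta> * block_norm i (Y t) + ?K * prev_norm i (Y t)" for i
    define W where "W = (\<Sum>i\<in>blocks. \<delta> ^ i)"
    have W: "0 < W" unfolding W_def using \<delta> k_le by (intro sum_pos) auto
    \<comment> \<open>The strict inequality in \<open>c\<close> leaves a slack \<open>s\<close>;
      each block receives s / W, whose weighted sum is again \<open>s\<close>.\<close>
    define s where "s = c + \<eta> / 2 * weighted_norm \<delta> (Y t)"
    have s: "0 < s" using c by (simp add: s_def)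
    have "(\<Sum>i\<in>blocks. \<delta> ^ i * L i) =
        - \<eta> * weighted_norm \<delta> (Y t) + ?K * (\<Sum>i\<in>blocks. \<delta> ^ i * prev_norm i (Y t))"
      unfolding L_def weighted_norm_def by (simp add: algebra_simps sum_subtractf sum_negf sum_distrib_left)
    also have "\<dots> \<le> - \<eta> * weighted_norm \<delta> (Y t) + ?K * (\<delta> * weighted_norm \<delta> (Y t))"
      using sum_prev_norm_le[of \<delta> "Y t"] \<delta> K by (intro add_left_mono mult_left_mono) auto
    also have "?K * (\<delta> * weighted_norm \<delta> (Y t)) = \<eta> / 2 * weighted_norm \<delta> (Y t)"
      unfolding \<delta>(2)[symmetric] by simp
    finally have sumL: "(\<Sum>i\<in>blocks. \<delta> ^ i * L i) + s \<le> c" by (simp add: s_def)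
    have "\<forall>\<^sub>F e in at_right 0. block_norm i (Y (t + e)) \<le> block_norm i (Y t) + e * (L i + s / W)"
      if i: "i \<in> blocks" for i
    proof -
      let ?a = "n choose (k - i)" and ?b = "m choose i"
      have ab: "0 < ?a" "0 < ?b" using i by auto
      have "(matrix_measure ?a (lp_norm ?a (p i)) (add_compound n (k - i) (A t))
          + matrix_measure ?b (lp_norm ?b (p i)) (add_compound m i (B t))) * block_norm i (Y t)
          \<le> - \<eta> * block_norm i (Y t)"
        by (intro mult_right_mono meas t i block_norm_nonneg)
      moreover have "grid_norm ?a ?b (p i) (lower_coupling (J t) i (Y t)) \<le> ?K * prev_norm i (Y t)"
        by (intro grid_norm_lower_coupling_le Y i C J21 t)
      moreover have "0 < s / W" using s W by simp
      ultimately have "(matrix_measure ?a (lp_norm ?a (p i)) (add_compound n (k - i) (A t))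
          + matrix_measure ?b (lp_norm ?b (p i)) (add_compound m i (B t))) * block_norm i (Y t)
          + grid_norm ?a ?b (p i) (lower_coupling (J t) i (Y t)) < L i + s / W"
        by (simp add: L_def)
      then show ?thesis unfolding block_norm_def
        by (intro dini_grid_norm[OF p[OF i] ab t block_deriv[OF t i]])
    qed
    then have "\<forall>\<^sub>F e in at_right 0. \<forall>i\<in>blocks. block_norm i (Y (t + e)) \<le> block_norm i (Y t) + e * (L i + s / W)"
      by (intro eventually_ball_finite) auto
    then show "\<forall>\<^sub>F e in at_right 0. weighted_norm \<delta> (Y (t + e)) \<le> weighted_norm \<delta> (Y t) + e * c"
      using eventually_at_right_less[of 0]
    proof eventually_elim
      case (elim e)
      have "weighted_norm \<delta> (Y (t + e)) \<le> (\<Sum>i\<in>blocks. \<delta> ^ i * (block_norm i (Y t) + e * (L i + s / W)))"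
        unfolding weighted_norm_def using elim \<delta> by (intro sum_mono mult_left_mono) auto
      also have "\<dots> = weighted_norm \<delta> (Y t) + e * ((\<Sum>i\<in>blocks. \<delta> ^ i * L i) + (\<Sum>i\<in>blocks. \<delta> ^ i * (s / W)))"
        by (simp add: weighted_norm_def sum.distrib sum_distrib_left distrib_left mult_ac)
      also have "(\<Sum>i\<in>blocks. \<delta> ^ i * (s / W)) = s"
        using W by (simp add: sum_distrib_right[symmetric] sum_divide_distrib[symmetric] W_def[symmetric])
      also have "weighted_norm \<delta> (Y t) + e * ((\<Sum>i\<in>blocks. \<delta> ^ i * L i) + s) \<le> weighted_norm \<delta> (Y t) + e * c"
        using sumL elim by simp
      finally show ?case .
    qed
  qed
  \<comment> \<open>\<open>init\<close> fixes \<Phi> 0 only at indices below n + m, so functions are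
    compared just on the tuples that the norm reads.\<close>
  moreover have "weighted_norm \<delta> Z = weighted_norm \<delta> Z'"
    if "\<And>xs. length xs = k \<Longrightarrow> set xs \<subseteq> {..<?d} \<Longrightarrow> Z xs = Z' xs" for Z Z'
    unfolding weighted_norm_def block_norm_def
  proof (intro sum.cong refl arg_cong2[where f="(*)"] grid_norm_cong)
    fix i r c assume "i \<in> blocks" "r < n choose (k - i)" "c < m choose i"
    then show "block i Z r c = block i Z' r c"
      unfolding block_def by (intro that block_list_props) (auto intro: ktuples_nth)
  qed
  from this[of "Y 0" "tensor ?d k v (mat_id ?d)"]
    this[of "tensor ?d k (mat_vec (?d choose k) (mult_compound ?d ?d k (\<Phi> T)) v) (mat_id ?d)" "Y T"]
  have "weighted_norm \<delta> (Y 0) = 1"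
    "weighted_norm \<delta> (tensor ?d k (mat_vec (?d choose k) (mult_compound ?d ?d k (\<Phi> T)) v) (mat_id ?d)) = weighted_norm \<delta> (Y T)"
    using v(2) tensor_cong[OF init] tensor_mult_compound unfolding Y_def by auto
  ultimately show "weighted_norm \<delta> (tensor ?d k (mat_vec (?d choose k) (mult_compound ?d ?d k (\<Phi> T)) v) (mat_id ?d))
      \<le> exp (- (\<eta> / 2) * T)" by simp
qed

end


section \<open>The series interconnection\<close>

text \<open>The state is (x1, x2) while \<open>g2\<close> takes x2 first, so its joint derivative is
  composed with the swap. The upper right block vanishes because the first component sees only
  \<open>fst h\<close> and D1 0 = 0.\<close>

lemma jac_block_basis:
  fixes g1 :: "(real, 'n::{finite,linorder}) vec \<Rightarrow> (real, 'n) vec"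
    and g2 :: "(real, 'm::{finite,linorder}) vec \<Rightarrow> (real, 'n) vec \<Rightarrow> (real, 'm) vec"
  assumes g1: "(g1 has_derivative D1) (at x1)"
    and g2: "((\<lambda>(x2, x1). g2 x2 x1) has_derivative D2) (at (x2, x1))"
  defines "F \<equiv> \<lambda>(x1, x2). (g1 x1, g2 x2 x1)"
  shows "a < CARD('n) \<Longrightarrow> b < CARD('n) \<Longrightarrow>
      jac block_basis block_basis F (x1, x2) a b = jac std_basis std_basis g1 x1 a b"
    and "a < CARD('n) \<Longrightarrow> jac block_basis block_basis F (x1, x2) a (CARD('n) + b) = 0"
    and "b < CARD('n) \<Longrightarrow> jac block_basis block_basis F (x1, x2) (CARD('n) + c) b =
      jac std_basis std_basis (\<lambda>x1. g2 x2 x1) x1 c b"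
    and "jac block_basis block_basis F (x1, x2) (CARD('n) + c) (CARD('n) + d) =
      jac std_basis std_basis (\<lambda>x2. g2 x2 x1) x2 c d"
proof -
  have sw: "((\<lambda>z. (snd z, fst z)) has_derivative (\<lambda>h. (snd h, fst h))) (at (x1, x2))"
    by (auto intro!: derivative_eq_intros)
  have "((\<lambda>z. g2 (snd z) (fst z)) has_derivative (\<lambda>h. D2 (snd h, fst h))) (at (x1, x2))"
    using has_derivative_compose[OF sw, of "\<lambda>(x2, x1). g2 x2 x1" D2] g2 by simp
  moreover have "((\<lambda>z. g1 (fst z)) has_derivative (\<lambda>h. D1 (fst h))) (at (x1, x2))"
    using has_derivative_compose[OF has_derivative_fst[OF has_derivative_ident], of g1 D1 "(x1, x2)"] g1 by simp
  ultimately have "(F has_derivative (\<lambda>h. (D1 (fst h), D2 (snd h, fst h)))) (at (x1, x2))"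
    unfolding F_def case_prod_beta by (rule has_derivative_Pair[rotated])
  note F = frechet_derivative_at[OF this, symmetric] and G1 = frechet_derivative_at[OF g1, symmetric]
  \<comment> \<open>The partial Jacobians of \<open>g2\<close> are restrictions of its joint
    derivative to the slices (0, h) and (h, 0).\<close>
  have D2_fst: "((\<lambda>x1. g2 x2 x1) has_derivative (\<lambda>h. D2 (0, h))) (at x1)"
    using has_derivative_compose[OF has_derivative_Pair[OF has_derivative_const[of x2] has_derivative_ident],
      of "\<lambda>(x2, x1). g2 x2 x1" D2 x1] g2 by simp
  have D2_snd: "((\<lambda>x2. g2 x2 x1) has_derivative (\<lambda>h. D2 (h, 0))) (at x2)"
    using has_derivative_compose[OF has_derivative_Pair[OF has_derivative_ident has_derivative_const[of x1]],
      of "\<lambda>(x2, x1). g2 x2 x1" D2 x2] g2 by simp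
  have D1_0: "D1 0 = 0" by (rule linear_0[OF has_derivative_linear[OF g1]])
  note simps = jac_def F G1 frechet_derivative_at[OF D2_fst, symmetric] frechet_derivative_at[OF D2_snd, symmetric]
    block_basis_def D1_0
  show "a < CARD('n) \<Longrightarrow> b < CARD('n) \<Longrightarrow>
      jac block_basis block_basis F (x1, x2) a b = jac std_basis std_basis g1 x1 a b"
    and "a < CARD('n) \<Longrightarrow> jac block_basis block_basis F (x1, x2) a (CARD('n) + b) = 0"
    and "b < CARD('n) \<Longrightarrow> jac block_basis block_basis F (x1, x2) (CARD('n) + c) b =
      jac std_basis std_basis (\<lambda>x1. g2 x2 x1) x1 c b"
    and "jac block_basis block_basis F (x1, x2) (CARD('n) + c) (CARD('n) + d) =
      jac std_basis std_basis (\<lambda>x2. g2 x2 x1) x2 c d"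
    by (simp_all add: simps)
qed

text \<open>\<open>jac\<close> rests on \<open>frechet_derivative\<close>, an arbitrary choice
  unless a derivative exists; restricting the joint derivative to directions (0, h) supplies one at
  each fixed time.\<close>

lemma C1_on_has_derivative_section:
  assumes "C1_on U (\<lambda>(t, x). f t x)" "(t, x) \<in> U"
  shows "\<exists>D. (f t has_derivative D) (at x)"
proof -
  obtain D where D: "((\<lambda>(t, x). f t x) has_derivative D) (at (t, x))"
    using assms unfolding C1_on_def by blast
  have "(f t has_derivative (\<lambda>h. D (0, h))) (at x)"
    using has_derivative_compose[OF has_derivative_Pair[OF has_derivative_const[of t] has_derivative_ident],
      of "\<lambda>(t, x). f t x" D x] D by simp
  then show ?thesis by blast
qed

theorem theorem2:
  fixes f1 :: "real \<Rightarrow> (real, 'n::{finite,linorder}) vec \<Rightarrow> (real, 'n) vec"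
    and f2 :: "real \<Rightarrow> (real, 'm::{finite,linorder}) vec \<Rightarrow> (real, 'n) vec \<Rightarrow> (real, 'm) vec"
    and \<Omega>1 :: "((real, 'n) vec) set" and \<Omega>2 :: "((real, 'm) vec) set"
    and U1 :: "(real \<times> ((real, 'n) vec)) set" and U2 :: "(real \<times> ((real, 'm) vec) \<times> ((real, 'n) vec)) set"
    and k :: nat and p :: "nat \<Rightarrow> ereal" and \<eta> :: "nat \<Rightarrow> real"
  assumes C1_f1: "open U1" "{0..} \<times> \<Omega>1 \<subseteq> U1" "C1_on U1 (\<lambda>(t, x1). f1 t x1)"
    and C1_f2: "open U2" "{0..} \<times> (\<Omega>2 \<times> \<Omega>1) \<subseteq> U2" "C1_on U2 (\<lambda>(t, x2, x1). f2 t x2 x1)"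
    and cvx: "convex (\<Omega>1 \<times> \<Omega>2)"
    and J21_bdd: "\<exists>B. \<forall>t\<ge>0. \<forall>x1\<in>\<Omega>1. \<forall>x2\<in>\<Omega>2. \<forall>i<CARD('m). \<forall>j<CARD('n).
                    \<bar>jac std_basis std_basis (\<lambda>y. f2 t x2 y) x1 i j\<bar> \<le> B"
    and k: "1 \<le> k" "k \<le> CARD('n) + CARD('m)"
    and meas: "\<forall>i\<in>{k - CARD('n) .. min CARD('m) k}. 1 \<le> p i \<and> 0 < \<eta> i \<and>
       (\<forall>t\<ge>0. \<forall>x1\<in>\<Omega>1. \<forall>x2\<in>\<Omega>2.
          matrix_measure (CARD('n) choose (k - i)) (lp_norm (CARD('n) choose (k - i)) (p i))
             (add_compound CARD('n) (k - i) (jac std_basis std_basis (f1 t) x1))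
        + matrix_measure (CARD('m) choose i) (lp_norm (CARD('m) choose i) (p i))
             (add_compound CARD('m) i (jac std_basis std_basis (\<lambda>y. f2 t y x1) x2))
        \<le> - \<eta> i)"
  shows "k_contracting k block_basis (\<lambda>t (x1, x2). (f1 t x1, f2 t x2 x1)) (\<Omega>1 \<times> \<Omega>2)"
proof -
  let ?n = "CARD('n)" and ?m = "CARD('m)" and ?R = "{k - CARD('n)..min CARD('m) k}"
  let ?F = "\<lambda>t (x1, x2). (f1 t x1, f2 t x2 x1)"
  interpret compound_blocks ?n ?m k p
    using k meas by unfold_locales auto
  obtain B where B: "\<And>t x1 x2 i j. 0 \<le> t \<Longrightarrow> x1 \<in> \<Omega>1 \<Longrightarrow> x2 \<in> \<Omega>2 \<Longrightarrow> i < ?m \<Longrightarrow> j < ?n \<Longrightarrow>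
      \<bar>jac std_basis std_basis (\<lambda>y. f2 t x2 y) x1 i j\<bar> \<le> B"
    using J21_bdd by blast
  \<comment> \<open>\<open>coupling_const_pos\<close> asks for a nonnegative bound, and
    \<open>B\<close> comes without a sign.\<close>
  define C where "C = max 0 B"
  \<comment> \<open>A common rate for all blocks; the finite range is nonempty because k <= n +
    m.\<close>
  define e where "e = Min (\<eta> ` ?R)"
  have "?R \<noteq> {}" using k by auto
  then have e: "0 < e" using meas by (simp add: e_def)
  have e_le: "e \<le> \<eta> i" if "i \<in> ?R" for i using that by (simp add: e_def)
  \<comment> \<open>\<delta> is fixed before any trajectory is taken, since the norm must be common
    to all of them.\<close>
  define \<delta> where "\<delta> = e / (2 * coupling_const C)"
  have "0 < coupling_const C" by (rule coupling_const_pos) (simp add: C_def)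
  then have \<delta>: "0 < \<delta>" using e by (simp add: \<delta>_def)
  have DIM: "DIM((real, 'n) vec \<times> (real, 'm) vec) = ?n + ?m" by simp
  show ?thesis
    unfolding k_contracting_def DIM
  proof (intro exI conjI allI impI)
    show "0 < e / 2" using e by simp
    show "is_norm_on (?n + ?m choose k) (\<lambda>v. weighted_norm \<delta> (tensor (?n + ?m) k v (mat_id (?n + ?m))))"
      by (rule is_norm_on_weighted_norm[OF \<delta>])
  next
    fix z :: "real \<Rightarrow> (real, 'n) vec \<times> (real, 'm) vec" and \<Phi> :: "real \<Rightarrow> nmat" and T :: real
    assume z\<Phi>: "(\<forall>t\<ge>0. z t \<in> \<Omega>1 \<times> \<Omega>2 \<and> (z has_vector_derivative ?F t (z t)) (at t within {0..})) \<and>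
        (\<forall>i<?n + ?m. \<forall>j<?n + ?m. \<Phi> 0 i j = mat_id (?n + ?m) i j \<and>
        (\<forall>t\<ge>0. ((\<lambda>s. \<Phi> s i j) has_real_derivative
          (\<Sum>l<?n + ?m. jac block_basis block_basis (?F t) (z t) i l * \<Phi> t l j)) (at t within {0..})))"
      and T: "0 \<le> T"
    note z = conjunct1[OF z\<Phi>] and \<Phi> = conjunct2[OF z\<Phi>]
    define x1 x2 where "x1 t = fst (z t)" and "x2 t = snd (z t)" for t
    have zx: "z t = (x1 t, x2 t)" for t by (simp add: x1_def x2_def)
    have x: "x1 t \<in> \<Omega>1" "x2 t \<in> \<Omega>2" if "0 \<le> t" for t
      using z that by (auto simp: zx)
    have "\<exists>D1 D2. (f1 t has_derivative D1) (at (x1 t)) \<and>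
        ((\<lambda>(x2, x1). f2 t x2 x1) has_derivative D2) (at (x2 t, x1 t))" if "0 \<le> t" for t
    proof -
      have "(t, x1 t) \<in> U1" "(t, (x2 t, x1 t)) \<in> U2" using C1_f1(2) C1_f2(2) x[OF that] that by auto
      then show ?thesis
        using C1_on_has_derivative_section[OF C1_f1(3), of t "x1 t"]
          C1_on_has_derivative_section[of U2 "\<lambda>t (x2, x1). f2 t x2 x1" t "(x2 t, x1 t)"] C1_f2(3) by blast
    qed
    then obtain D1 D2 where D: "\<And>t. 0 \<le> t \<Longrightarrow> (f1 t has_derivative D1 t) (at (x1 t))"
      "\<And>t. 0 \<le> t \<Longrightarrow> ((\<lambda>(x2, x1). f2 t x2 x1) has_derivative D2 t) (at (x2 t, x1 t))"
      by metis
    note J = jac_block_basis[OF D, folded zx]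
    show "induced_norm (?n + ?m choose k) (\<lambda>v. weighted_norm \<delta> (tensor (?n + ?m) k v (mat_id (?n + ?m))))
        (mult_compound (?n + ?m) (?n + ?m) k (\<Phi> T)) \<le> exp (- (e / 2) * T)"
      unfolding \<delta>_def
    proof (rule mult_compound_decay[where J="\<lambda>t. jac block_basis block_basis (?F t) (z t)"
          and A="\<lambda>t. jac std_basis std_basis (f1 t) (x1 t)"
          and B="\<lambda>t. jac std_basis std_basis (\<lambda>y. f2 t y (x1 t)) (x2 t)"])
      fix t :: real and i assume t: "0 \<le> t" and i: "i \<in> ?R"
      have "matrix_measure (?n choose (k - i)) (lp_norm (?n choose (k - i)) (p i))
          (add_compound ?n (k - i) (jac std_basis std_basis (f1 t) (x1 t)))
        + matrix_measure (?m choose i) (lp_norm (?m choose i) (p i))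
          (add_compound ?m i (jac std_basis std_basis (\<lambda>y. f2 t y (x1 t)) (x2 t))) \<le> - \<eta> i"
        using meas i t x[OF t] by blast
      then show "matrix_measure (?n choose (k - i)) (lp_norm (?n choose (k - i)) (p i))
          (add_compound ?n (k - i) (jac std_basis std_basis (f1 t) (x1 t)))
        + matrix_measure (?m choose i) (lp_norm (?m choose i) (p i))
          (add_compound ?m i (jac std_basis std_basis (\<lambda>y. f2 t y (x1 t)) (x2 t))) \<le> - e"
        using e_le[OF i] by linarith
    next
      fix t :: real and a b :: nat assume t: "0 \<le> t" and ab: "a < ?m" "b < ?n"
      show "\<bar>jac block_basis block_basis (?F t) (z t) (?n + a) b\<bar> \<le> C"
        unfolding J(3)[OF t t ab(2)] using B[OF t x[OF t] ab] by (simp add: C_def)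
    next
      fix t :: real assume t: "0 \<le> t"
      show "a < ?n \<Longrightarrow> b < ?n \<Longrightarrow> jac block_basis block_basis (?F t) (z t) a b =
          jac std_basis std_basis (f1 t) (x1 t) a b"
        and "a < ?n \<Longrightarrow> jac block_basis block_basis (?F t) (z t) a (?n + b) = 0"
        and "jac block_basis block_basis (?F t) (z t) (?n + a) (?n + b) =
          jac std_basis std_basis (\<lambda>y. f2 t y (x1 t)) (x2 t) a b" for a b
        using J(1,2,4)[OF t t] by blast+
    next
      show "0 < e" "0 \<le> C" "0 \<le> T" using e T by (simp_all add: C_def)
    next
      fix i j assume ij: "i < ?n + ?m" "j < ?n + ?m"
      then show "\<Phi> 0 i j = mat_id (?n + ?m) i j" using \<Phi> by blast
      fix t :: real assume "0 \<le> t"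
      then show "((\<lambda>s. \<Phi> s i j) has_real_derivative
          (\<Sum>l<?n + ?m. jac block_basis block_basis (?F t) (z t) i l * \<Phi> t l j)) (at t within {0..})"
        using \<Phi> ij by blast
    qed
  qed
qed

end
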